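(* For the triangle partition map $T_{e,23,e}$, for almost every $(x,y)\in\triangle$ the limiting digit frequencies $P_k(x,y)$ exist for all $k\ge0$ and equal $p(k)$, where $$p(0)=\frac12,$$ while for $k>0$, $$p(k)=\int_{\frac{1}{k+2}}^{\frac{1}{k+1}}\left(\int_{\frac{1-x}{k+1}}^{x}\frac{6}{\pi^2x(1-y)}\,dy\right)dx+\int_{\frac{1}{k+1}}^{1}\left(\int_{\frac{1-x}{k+1}}^{\frac{1-x}{k}}\frac{6}{\pi^2x(1-y)}\,dy\right)dx .$$
   Context: Let $\triangle=\{(x,y)\in\mathbb{R}^2: 0<y<x<1\}$. For $k\ge0$ and $(x,y)\in\triangle$ let $$S_k(x,y)=\left(\frac{1}{kx+x-y+1},\ \frac{x}{kx+x-y+1}\right).$$ $S_k$ maps $\triangle$ bijectively onto an open subtriangle $\triangle_k\subset\triangle$; the $\triangle_k$ are pairwise disjoint and cover $\triangle$ up to a null set. The triangle partition map $T=T_{e,23,e}$ is defined on $\bigcup_k\triangle_k$ by $T=S_k^{-1}$ on $\triangle_k$, i.e. $T(x,y)=\left(\frac{y}{x},\frac{x+ky+y-1}{x}\right)$ for $(x,y)\in\triangle_k$. The expansion of (almost every) $(x,y)\in\triangle$ is the sequence $(a_1,a_2,\dots)$ of nonnegative integers with $T^{i-1}(x,y)\in\triangle_{a_i}$. Set $P_{n,k}(x,y)=\frac{\#\{i:1\le i\le n,\ a_i=k\}}{n}$ and, if the limit exists, $P_k(x,y)=\lim_{n\to\infty}P_{n,k}(x,y)$. $p(k)$ denotes the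 common value of $P_k(x,y)$ for almost all (Lebesgue) $(x,y)\in\triangle$. *)

theory Defs
  imports "HOL-Analysis.Analysis"
begin

definition open_triangle :: "(real \<times> real) set" where
  "open_triangle = {(x, y). 0 < y \<and> y < x \<and> x < 1}"

definition S_map :: "nat \<Rightarrow> real \<times> real \<Rightarrow> real \<times> real" where
  "S_map k = (\<lambda>(x, y). (1 / (real k * x + x - y + 1), x / (real k * x + x - y + 1)))"

definition subtriangle :: "nat \<Rightarrow> (real \<times> real) set" where
  "subtriangle k = S_map k ` open_triangle"

text \<open>
  \<open>first_digit\<close> and \<open>T_map\<close> are meaningful only on the union of the
  subtriangles, where the triangle map is defined; the predicate \<open>has_expansion\<close> below says that
  the whole forward orbit stays there. On that union the index is unique by
  \<open>subtriangle_disjoint\<close>, and \<open>T_map_eq\<close> gives the closed form of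
  the map.
\<close>

definition first_digit :: "real \<times> real \<Rightarrow> nat" where
  "first_digit z = (THE k. z \<in> subtriangle k)"

definition T_map :: "real \<times> real \<Rightarrow> real \<times> real" where
  "T_map z = inv_into open_triangle (S_map (first_digit z)) z"

definition digit :: "real \<times> real \<Rightarrow> nat \<Rightarrow> nat" where
  "digit z i = first_digit ((T_map ^^ (i - 1)) z)"

definition has_expansion :: "real \<times> real \<Rightarrow> bool" where
  "has_expansion z \<longleftrightarrow> (\<forall>i\<ge>1. (T_map ^^ (i - 1)) z \<in> (\<Union>k. subtriangle k))"

definition freq_upto :: "nat \<Rightarrow> nat \<Rightarrow> real \<times> real \<Rightarrow> real" where
  "freq_upto n k z = real (card {i. 1 \<le> i \<and> i \<le> n \<and> digit z i = k}) / real n"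

definition freq_exists :: "nat \<Rightarrow> real \<times> real \<Rightarrow> bool" where
  "freq_exists k z \<longleftrightarrow> has_expansion z \<and> convergent (\<lambda>n. freq_upto n k z)"

definition freq :: "nat \<Rightarrow> real \<times> real \<Rightarrow> real" where
  "freq k z = lim (\<lambda>n. freq_upto n k z)"

definition p_freq :: "nat \<Rightarrow> real" where
  "p_freq k = (THE c. AE z in lebesgue_on open_triangle. freq_exists k z \<and> freq k z = c)"

lemma inj_on_S_map: "inj_on (S_map k) open_triangle"
proof (rule inj_onI, clarify)
  fix x y x' y' :: real
  assume "(x, y) \<in> open_triangle" "(x', y') \<in> open_triangle" and eq: "S_map k (x, y) = S_map k (x', y')"
  then have b: "0 < y" "y < x" "0 < y'" "y' < x'"
    by (auto simp: open_triangle_def)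
  define D D' where "D = real k * x + x - y + 1" and "D' = real k * x' + x' - y' + 1"
  have "0 \<le> real k * x" "0 \<le> real k * x'"
    using b by auto
  then have pos: "D > 0" "D' > 0"
    using b unfolding D_def D'_def by linarith+
  have e: "1 / D = 1 / D'" "x / D = x' / D'"
    using eq unfolding S_map_def D_def D'_def prod.case prod.inject by blast+
  have "D = D'" using e(1) by simp
  have "x = x'" using e(2) pos unfolding \<open>D = D'\<close> by simp
  with \<open>D = D'\<close> have "y = y'" by (simp add: D_def D'_def)
  with \<open>x = x'\<close> show "x = x' \<and> y = y'" by simp
qed

lemma S_map_inverse_formula:
  assumes "x \<noteq> 0"
  shows "S_map k (y / x, (x + real k * y + y - 1) / x) = (x, y)"
proof -
  have "real k * (y / x) + y / x - (x + real k * y + y - 1) / x + 1 = 1 / x"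
    using assms by (simp add: field_simps)
  then show ?thesis using assms by (simp add: S_map_def)
qed

lemma mem_subtriangle_iff:
  "(x, y) \<in> subtriangle k \<longleftrightarrow>
     0 < x \<and> y < x \<and> real k * y + x < 1 \<and> 1 < (real k + 1) * y + x"
proof
  assume "(x, y) \<in> subtriangle k"
  then obtain u v where uv: "0 < v" "v < u" "u < 1" and eq: "(x, y) = S_map k (u, v)"
    by (auto simp: subtriangle_def open_triangle_def)
  define D where "D = real k * u + u - v + 1"
  have "0 \<le> real k * u" using uv by simp
  then have D: "D > 1" using uv unfolding D_def by linarith
  have xy: "x = 1 / D" "y = u / D" using eq by (simp_all add: S_map_def D_def)
  show "0 < x \<and> y < x \<and> real k * y + x < 1 \<and> 1 < (real k + 1) * y + x"
    using uv D unfolding xy by (simp add: divide_simps) (simp add: D_def algebra_simps)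
next
  assume a: "0 < x \<and> y < x \<and> real k * y + x < 1 \<and> 1 < (real k + 1) * y + x"
  then have "(y / x, (x + real k * y + y - 1) / x) \<in> open_triangle"
    by (simp add: open_triangle_def divide_simps) (simp add: algebra_simps)
  moreover have "S_map k (y / x, (x + real k * y + y - 1) / x) = (x, y)"
    using a by (intro S_map_inverse_formula) auto
  ultimately show "(x, y) \<in> subtriangle k"
    unfolding subtriangle_def by (metis imageI)
qed

lemma subtriangle_subset: "subtriangle k \<subseteq> open_triangle"
proof (clarify)
  fix x y assume "(x, y) \<in> subtriangle k"
  then have a: "0 < x" "y < x" "real k * y + x < 1" "1 < (real k + 1) * y + x"
    by (auto simp: mem_subtriangle_iff)
  have "0 < y" using a(3,4) by (simp add: algebra_simps)
  moreover from this have "0 \<le> real k * y" by simp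
  then have "x < 1" using a(3) by linarith
  ultimately show "(x, y) \<in> open_triangle" using a by (simp add: open_triangle_def)
qed

lemma subtriangle_disjoint:
  assumes "z \<in> subtriangle j" "z \<in> subtriangle k"
  shows "j = k"
proof -
  have *: False if "j < k" "(x, y) \<in> subtriangle j" "(x, y) \<in> subtriangle k" for j k x y
  proof -
    have y: "0 < y" using that(2) subtriangle_subset by (fastforce simp: open_triangle_def)
    have "real j + 1 \<le> real k" using that(1) by simp
    then have "(real j + 1) * y \<le> real k * y" using y by (intro mult_right_mono) auto
    then show False using that by (auto simp: mem_subtriangle_iff)
  qed
  obtain x y where "z = (x, y)" by (cases z)
  then show ?thesis using assms * by (metis linorder_neqE_nat)
qed

lemma first_digit_eq:
  assumes "z \<in> subtriangle k"
  shows "first_digit z = k"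
  unfolding first_digit_def using assms subtriangle_disjoint by (intro the_equality) auto

lemma T_map_eq:
  assumes "(x, y) \<in> subtriangle k"
  shows "T_map (x, y) = (y / x, (x + real k * y + y - 1) / x)"
proof -
  have a: "0 < x \<and> y < x \<and> real k * y + x < 1 \<and> 1 < (real k + 1) * y + x"
    using assms by (simp add: mem_subtriangle_iff)
  then have "(y / x, (x + real k * y + y - 1) / x) \<in> open_triangle"
    by (simp add: open_triangle_def divide_simps) (simp add: algebra_simps)
  moreover have "S_map k (y / x, (x + real k * y + y - 1) / x) = (x, y)"
    using a by (intro S_map_inverse_formula) auto
  ultimately show ?thesis
    unfolding T_map_def first_digit_eq[OF assms] by (metis inj_on_S_map inv_into_f_f)
qed

end

theory Submission
  imports Defs "HOL-Probability.Probability_Measure"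
begin

text \<open>
  The frequency of a digit \<open>k\<close> along an orbit is the average number of visits to \<open>subtriangle k\<close>. The
  triangle map preserves the probability measure \<open>\<mu>\<close> with density \<open>6 / (pi\<^sup>2 * x * (1 - y))\<close> on the
  triangle, and \<open>\<mu>\<close> is ergodic. The pointwise ergodic theorem (\<open>birkhoff\<close>) therefore gives the frequency
  \<open>\<mu> (subtriangle k)\<close> at almost every point (\<open>AE_digit_frequencies\<close>, \<open>p_freq_eq\<close>), and it remains to
  compute these measures. The subtriangle of the digit \<open>0\<close> is one half of the triangle with respect to
  a reflection that preserves \<open>\<mu>\<close> (\<open>measure_subtriangle_0\<close>); for \<open>k > 0\<close> the stated integrals are
  Fubini's theorem applied to \<open>subtriangle k\<close> (\<open>measure_subtriangle_pos\<close>).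

  Invariance rests on a telescoping series (\<open>transfer_invariant_density\<close>). The branch \<open>S_map k\<close> has
  Jacobian \<open>1 / D k ^ 3\<close>, where \<open>D k\<close> is its denominator at the point \<open>(u, v)\<close>. The density at the image,
  multiplied by the Jacobian, is proportional to \<open>1 / (D k * D (k - 1))\<close>, and \<open>D k - D (k - 1) = u\<close>.

  For ergodicity, pass to homogeneous coordinates in which every branch is a linear map with nonnegative
  coefficients. Call a word of digits positive if all entries of the product of its matrices are
  positive. Two things hold for the words \<open>w @ g\<close> that end in a fixed positive word \<open>g\<close>, uniformly in
  \<open>w\<close>: the Jacobian of the corresponding composition of branches varies by a bounded factor
  (\<open>weight_vec_word_positive_bounds\<close>), and the diameter of the cylinder of \<open>w @ g\<close> is smaller than that of
  \<open>w\<close> by a fixed factor (\<open>spread_le_positive\<close>). Each infinite expansion has a positive prefix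
  (\<open>exists_positive_prefix\<close>): a product of matrices fails to become positive only if all digits at the
  even places or all digits at the odd places vanish, and then a positive quantity would drop by \<open>1\<close> in
  every second step. By Poincare recurrence (\<open>recurrence\<close>) this prefix reappears infinitely often along
  almost every orbit. So almost every point has arbitrarily small cylinders around it in which a given
  invariant set of positive measure fills at least a fixed proportion, and a covering argument shows
  that the complement of the invariant set is null (\<open>recurrent_complement_null\<close>).
\<close>

section \<open>Recurrence and the pointwise ergodic theorem\<close>

locale measure_preserving = prob_space M for M :: "'a measure" +
  fixes T :: "'a \<Rightarrow> 'a"
  assumes T_measurable [measurable]: "T \<in> measurable M M"
    and distr_T: "distr M M T = M"
begin

lemma funpow_measurable [measurable]: "(T ^^ n) \<in> measurable M M"
  by (induction n) auto

lemma emeasure_vimage_T: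
  assumes "A \<in> sets M"
  shows "emeasure M (T -` A \<inter> space M) = emeasure M A"
  using emeasure_distr[OF T_measurable assms] by (simp add: distr_T)

lemma AE_orbit:
  assumes "AE z in M. P z"
  shows "AE z in M. \<forall>n. P ((T ^^ n) z)"
proof -
  have "AE z in M. P ((T ^^ n) z)" for n
  proof (induction n)
    case (Suc n)
    then have "AE z in distr M M T. P ((T ^^ n) z)"
      unfolding distr_T .
    from AE_distrD[OF T_measurable this] show ?case
      by (simp only: funpow_Suc_right o_apply)
  qed (use assms in simp)
  then show ?thesis
    by (simp add: AE_all_countable)
qed

text \<open>
  The sets \<open>U n\<close> of points that visit \<open>B\<close> at some time \<open>\<ge> n\<close> decrease, and each is the preimage of
  the one before. They all have the same finite measure, so they agree up to null sets.
\<close>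

lemma recurrence:
  assumes [measurable]: "B \<in> sets M"
  shows "AE z in M. (\<exists>j. (T ^^ j) z \<in> B) \<longrightarrow> (\<forall>n. \<exists>j\<ge>n. (T ^^ j) z \<in> B)"
proof -
  define U where "U n = {z \<in> space M. \<exists>j\<ge>n. (T ^^ j) z \<in> B}" for n
  have [measurable]: "U n \<in> sets M" for n
    unfolding U_def by measurable
  have "U (Suc n) = T -` U n \<inter> space M" for n
  proof (intro set_eqI iffI)
    fix z assume "z \<in> U (Suc n)"
    then obtain j where j: "z \<in> space M" "Suc n \<le> j" "(T ^^ j) z \<in> B"
      by (auto simp: U_def)
    then obtain i where "j = Suc i" "n \<le> i" by (cases j) auto
    with j show "z \<in> T -` U n \<inter> space M"
      using measurable_space[OF T_measurable] by (auto simp: U_def funpow_swap1 intro!: exI[of _ i])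
  next
    fix z assume "z \<in> T -` U n \<inter> space M"
    then obtain j where "z \<in> space M" "n \<le> j" "(T ^^ j) (T z) \<in> B"
      by (auto simp: U_def)
    then show "z \<in> U (Suc n)"
      by (auto simp: U_def funpow_swap1 intro!: exI[of _ "Suc j"])
  qed
  then have eq: "emeasure M (U n) = emeasure M (U 0)" for n
    by (induction n) (simp_all add: emeasure_vimage_T)
  have "AE z in M. z \<notin> U 0 - U n" for n
  proof (rule AE_not_in)
    have "emeasure M (U 0 - U n) = emeasure M (U 0) - emeasure M (U n)"
      by (rule emeasure_Diff) (auto simp: U_def)
    then show "U 0 - U n \<in> null_sets M" 
      unfolding eq[of n] by (intro null_setsI) (simp_all add: less_top[symmetric])
  qed
  then have "AE z in M. \<forall>n. z \<notin> U 0 - U n"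
    unfolding AE_all_countable by blast
  then show ?thesis
    using AE_space by eventually_elim (auto simp: U_def)
qed

text \<open>
  The maximum of the partial sums \<open>\<Sum>i<m. f ((T ^^ i) z)\<close> over \<open>m \<le> n\<close>, the empty sum included. The
  recursion holds because a nonempty sum starting at \<open>z\<close> is \<open>f z\<close> plus a sum starting at \<open>T z\<close>; it
  contains everything that the maximal inequality needs.
\<close>

primrec max_sum :: "('a \<Rightarrow> real) \<Rightarrow> nat \<Rightarrow> 'a \<Rightarrow> real" where
  "max_sum f 0 z = 0"
| "max_sum f (Suc n) z = max 0 (f z + max_sum f n (T z))"

lemma max_sum_measurable [measurable]:
  assumes [measurable]: "f \<in> borel_measurable M"
  shows "max_sum f n \<in> borel_measurable M"
proof (induction n)
  case 0
  have "max_sum f 0 = (\<lambda>_. 0)" by auto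
  then show ?case by simp
next
  case (Suc n)
  note [measurable] = Suc
  have "max_sum f (Suc n) = (\<lambda>z. max 0 (f z + max_sum f n (T z)))" by auto
  then show ?case by simp
qed

lemma max_sum_nonneg: "0 \<le> max_sum f n z"
  by (cases n) auto

lemma max_sum_Suc_mono: "max_sum f n z \<le> max_sum f (Suc n) z"
proof (induction n arbitrary: z)
  case (Suc n)
  have "max_sum f n (T z) \<le> max_sum f (Suc n) (T z)" by (rule Suc)
  then show ?case
    unfolding max_sum.simps(2)[of f "Suc n"] max_sum.simps(2)[of f n z] by auto
qed simp

lemma max_sum_mono: "m \<le> n \<Longrightarrow> max_sum f m z \<le> max_sum f n z"
  by (rule lift_Suc_mono_le[of "\<lambda>n. max_sum f n z"]) (rule max_sum_Suc_mono)

lemma max_sum_bounded: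
  assumes "\<And>z. z \<in> space M \<Longrightarrow> f z \<le> C" "0 \<le> C" "z \<in> space M"
  shows "max_sum f n z \<le> real n * C"
  using assms(3)
proof (induction n arbitrary: z)
  case (Suc n)
  have "max_sum f n (T z) \<le> real n * C"
    using Suc measurable_space[OF T_measurable] by blast
  moreover have "f z \<le> C" using Suc assms by blast
  ultimately show ?case using assms(2) by (simp add: algebra_simps)
qed simp

lemma sum_le_max_sum: "(\<Sum>i<n. f ((T ^^ i) z)) \<le> max_sum f n z"
proof (induction n arbitrary: z)
  case (Suc n)
  have "(\<Sum>i<Suc n. f ((T ^^ i) z)) = f z + (\<Sum>i<n. f ((T ^^ i) (T z)))"
    by (subst sum.lessThan_Suc_shift) (simp add: funpow_swap1)
  also have "\<dots> \<le> f z + max_sum f n (T z)" using Suc by simp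
  finally show ?case by simp
qed simp

text \<open>
  Where the maximum is positive it is attained by a nonempty sum, so it exceeds the maximum at the
  next orbit point by at most \<open>f z\<close>. Where it is zero, the left-hand side is nonpositive.
\<close>

lemma max_sum_pos_step:
  "max_sum f n z - max_sum f n (T z) \<le> f z * indicator {z. max_sum f n z > 0} z"
proof (cases "max_sum f n z > 0")
  case True
  then obtain m where n: "n = Suc m" by (cases n) auto
  have "max_sum f n z = f z + max_sum f m (T z)" using True by (simp add: n max_def split: if_splits)
  also have "\<dots> \<le> f z + max_sum f n (T z)"
    unfolding n by (intro add_left_mono max_sum_Suc_mono)
  finally show ?thesis using True by simp
next
  case False
  then show ?thesis using max_sum_nonneg[of f n "T z"] by simp
qed

text \<open>
  Integrating \<open>max_sum_pos_step\<close>, the left-hand side has integral zero by invariance, so \<open>f\<close> has a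
  nonnegative integral over the set where \<open>max_sum f n > 0\<close>. By hypothesis these sets exhaust the
  space as \<open>n\<close> grows.
\<close>

lemma maximal_inequality:
  fixes f :: "'a \<Rightarrow> real"
  assumes [measurable]: "f \<in> borel_measurable M"
    and bounded: "\<And>z. z \<in> space M \<Longrightarrow> \<bar>f z\<bar> \<le> C"
    and pos: "AE z in M. \<exists>n. 0 < (\<Sum>i<n. f ((T ^^ i) z))"
  shows "0 \<le> expectation f"
proof -
  obtain z0 where "z0 \<in> space M" using not_empty by blast
  then have C: "0 \<le> C" using bounded[of z0] abs_ge_zero[of "f z0"] by linarith
  define g where "g n z = f z * indicator {z. max_sum f n z > 0} z" for n z
  have [measurable]: "g n \<in> borel_measurable M" for n
    unfolding g_def indicator_def by measurable
  have "0 \<le> expectation (g n)" for n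
  proof -
    have int: "integrable M (max_sum f n)"
    proof (rule integrable_const_bound[where B = "real n * C"])
      show "AE z in M. norm (max_sum f n z) \<le> real n * C"
        using max_sum_bounded[of f C] bounded C max_sum_nonneg[of f n]
        by (intro AE_I2) (auto simp: abs_le_iff)
    qed simp
    have int': "integrable M (\<lambda>z. max_sum f n (T z))"
      using integrable_distr[OF T_measurable, of "max_sum f n"] int by (simp add: distr_T)
    have "expectation (\<lambda>z. max_sum f n (T z)) = expectation (max_sum f n)"
      using integral_distr[OF T_measurable, of "max_sum f n"] by (simp add: distr_T)
    then have "0 = expectation (\<lambda>z. max_sum f n z - max_sum f n (T z))"
      using int int' by simp
    also have "\<dots> \<le> expectation (g n)"
    proof (rule integral_mono)
      show "integrable M (g n)"
        using bounded C by (intro integrable_const_bound[where B = C] AE_I2)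
          (auto simp: g_def indicator_def)
      show "max_sum f n z - max_sum f n (T z) \<le> g n z" for z
        unfolding g_def by (rule max_sum_pos_step)
    qed (use int int' in simp)
    finally show ?thesis .
  qed
  moreover have "(\<lambda>n. expectation (g n)) \<longlonglongrightarrow> expectation f"
  proof (rule integral_dominated_convergence[where w = "\<lambda>_. C"])
    show "AE z in M. (\<lambda>n. g n z) \<longlonglongrightarrow> f z"
      using pos
    proof eventually_elim
      fix z assume "\<exists>n. 0 < (\<Sum>i<n. f ((T ^^ i) z))"
      then obtain n where n: "0 < max_sum f n z"
        using sum_le_max_sum by (metis order_less_le_trans)
      have "g m z = f z" if "n \<le> m" for m
        using n max_sum_mono[OF that, of f z] by (simp add: g_def)
      then show "(\<lambda>n. g n z) \<longlonglongrightarrow> f z"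
        by (intro tendsto_eventually) (auto simp: eventually_sequentially)
    qed
    show "AE z in M. norm (g n z) \<le> C" for n
      using bounded C by (intro AE_I2) (auto simp: g_def indicator_def)
  qed auto
  ultimately show ?thesis
    by (intro LIMSEQ_le_const) auto
qed

end

locale ergodic_transformation = measure_preserving +
  assumes ergodic: "A \<in> sets M \<Longrightarrow> T -` A \<inter> space M = A \<Longrightarrow> emeasure M A = 0 \<or> emeasure M (space M - A) = 0"
begin

text \<open>
  The upper limit of the averages is an invariant function, so for every \<open>\<alpha>\<close> larger than the mean
  the set where it exceeds \<open>\<alpha>\<close> is null or of full measure. The second case is impossible: the partial
  sums of \<open>f - \<alpha>\<close> would be positive somewhere along almost every orbit, and the maximal inequality
  would give \<open>f - \<alpha>\<close> a nonnegative mean.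
\<close>

lemma limsup_average_le:
  fixes f :: "'a \<Rightarrow> real"
  assumes [measurable]: "f \<in> borel_measurable M"
    and bounded: "\<And>z. z \<in> space M \<Longrightarrow> \<bar>f z\<bar> \<le> C"
  shows "AE z in M. limsup (\<lambda>n. ereal ((\<Sum>i<n. f ((T ^^ i) z)) / real n)) \<le> expectation f"
proof -
  define avg where "avg z n = (\<Sum>i<n. f ((T ^^ i) z)) / real n" for z n
  define L where "L z = limsup (\<lambda>n. ereal (avg z n))" for z
  have [measurable]: "(\<lambda>z. avg z n) \<in> borel_measurable M" for n
    unfolding avg_def by measurable
  have [measurable]: "L \<in> borel_measurable M"
    unfolding L_def by measurable
  have int: "integrable M f"
    using bounded by (intro integrable_const_bound[where B = C] AE_I2) auto
  have L_T: "L (T z) = L z" if z: "z \<in> space M" for z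
  proof -
    \<comment> \<open>The averages at \<open>T z\<close> and at \<open>z\<close> differ by a boundary term that tends to zero.\<close>
    have "(\<lambda>n. (f ((T ^^ n) z) - f z) / real n) \<longlonglongrightarrow> 0"
    proof (rule Lim_null_comparison)
      show "\<forall>\<^sub>F n in sequentially. norm ((f ((T ^^ n) z) - f z) / real n) \<le> (2 * C) / real n"
      proof (intro always_eventually allI)
        fix n
        have "\<bar>f ((T ^^ n) z)\<bar> \<le> C" "\<bar>f z\<bar> \<le> C"
          using bounded z measurable_space[OF funpow_measurable z] by auto
        then show "norm ((f ((T ^^ n) z) - f z) / real n) \<le> (2 * C) / real n"
          by (auto intro!: divide_right_mono)
      qed
      show "(\<lambda>n. 2 * C / real n) \<longlonglongrightarrow> 0" by (rule lim_const_over_n)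
    qed
    then have "(\<lambda>n. ereal ((f ((T ^^ n) z) - f z) / real n)) \<longlonglongrightarrow> 0"
      by (simp add: zero_ereal_def)
    then have "limsup (\<lambda>n. ereal ((f ((T ^^ n) z) - f z) / real n) + ereal (avg z n)) = 0 + L z"
      unfolding L_def by (rule ereal_limsup_lim_add) simp
    moreover have "ereal ((f ((T ^^ n) z) - f z) / real n) + ereal (avg z n) = ereal (avg (T z) n)" for n
    proof -
      have "(\<Sum>i<n. f ((T ^^ i) (T z))) = (\<Sum>i<n. f ((T ^^ Suc i) z))"
        by (simp add: funpow_swap1)
      also have "\<dots> = (\<Sum>i<Suc n. f ((T ^^ i) z)) - f z"
        by (subst sum.lessThan_Suc_shift) simp
      finally show ?thesis unfolding avg_def by (simp add: add_divide_distrib diff_divide_distrib)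
    qed
    ultimately show ?thesis unfolding L_def by simp
  qed
  have "AE z in M. L z \<le> ereal \<alpha>" if \<alpha>: "expectation f < \<alpha>" for \<alpha>
  proof -
    define E where "E = {z \<in> space M. ereal \<alpha> < L z}"
    have [measurable]: "E \<in> sets M" unfolding E_def by measurable
    have "T -` E \<inter> space M = E"
      using L_T measurable_space[OF T_measurable] by (auto simp: E_def)
    from ergodic[OF _ this] have "emeasure M E = 0 \<or> emeasure M (space M - E) = 0" by simp
    moreover have "emeasure M (space M - E) \<noteq> 0"
    proof
      assume "emeasure M (space M - E) = 0"
      then have "AE z in M. z \<notin> space M - E"
        by (intro AE_not_in) auto
      then have "AE z in M. z \<in> E"
        using AE_space by eventually_elim auto
      then have "AE z in M. \<exists>n. 0 < (\<Sum>i<n. (\<lambda>z. f z - \<alpha>) ((T ^^ i) z))"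
      proof eventually_elim
        case (elim z)
        then have "\<exists>\<^sub>F n in sequentially. ereal \<alpha> < ereal (avg z n)"
          unfolding E_def L_def
          using Limsup_bounded[where X = "\<lambda>n. ereal (avg z n)" and F = sequentially and C = "ereal \<alpha>"]
          by (auto simp: frequently_def not_less)
        then have "\<exists>\<^sub>F n in sequentially. \<alpha> < avg z n \<and> 0 < n"
          using frequently_eventually_frequently[OF _ eventually_gt_at_top[of 0]] by auto
        then obtain n where n: "\<alpha> < avg z n" "0 < n"
          by (auto dest: frequently_ex)
        then show ?case
          by (intro exI[of _ n]) (simp add: avg_def field_simps sum_subtractf)
      qed
      then have "0 \<le> expectation (\<lambda>z. f z - \<alpha>)"
      proof (rule maximal_inequality[rotated -1])
        show "\<bar>f z - \<alpha>\<bar> \<le> C + \<bar>\<alpha>\<bar>" if "z \<in> space M" for z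
          using bounded[OF that] by linarith
      qed simp
      then show False using \<alpha> int by (simp add: prob_space)
    qed
    ultimately have "AE z in M. z \<notin> E" by (intro AE_not_in) auto
    then show ?thesis using AE_space by eventually_elim (auto simp: E_def)
  qed
  then have "AE z in M. \<forall>m. L z \<le> ereal (expectation f + inverse (real (Suc m)))"
    by (simp add: AE_all_countable)
  then show ?thesis
  proof eventually_elim
    case (elim z)
    have "(\<lambda>m. ereal (expectation f + inverse (real (Suc m)))) \<longlonglongrightarrow> ereal (expectation f + 0)"
      by (intro tendsto_ereal tendsto_intros LIMSEQ_inverse_real_of_nat)
    then have "L z \<le> ereal (expectation f + 0)"
      by (rule LIMSEQ_le_const) (use elim in blast)
    then show ?case by (simp add: L_def avg_def)
  qed
qed

text \<open>
  The upper limit bound for \<open>- f\<close> is the lower limit bound for \<open>f\<close>.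
\<close>

theorem birkhoff:
  fixes f :: "'a \<Rightarrow> real"
  assumes [measurable]: "f \<in> borel_measurable M"
    and bounded: "\<And>z. z \<in> space M \<Longrightarrow> \<bar>f z\<bar> \<le> C"
  shows "AE z in M. (\<lambda>n. (\<Sum>i<n. f ((T ^^ i) z)) / real n) \<longlonglongrightarrow> expectation f"
proof -
  have "AE z in M. limsup (\<lambda>n. ereal ((\<Sum>i<n. - f ((T ^^ i) z)) / real n)) \<le> expectation (\<lambda>z. - f z)"
    using limsup_average_le[of "\<lambda>z. - f z" C] bounded by simp
  moreover have "AE z in M. limsup (\<lambda>n. ereal ((\<Sum>i<n. f ((T ^^ i) z)) / real n)) \<le> expectation f"
    using bounded by (rule limsup_average_le[OF assms(1)])
  ultimately show ?thesis
  proof eventually_elim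
    case (elim z)
    let ?X = "\<lambda>n. ereal ((\<Sum>i<n. f ((T ^^ i) z)) / real n)"
    have "limsup (\<lambda>n. - ?X n) \<le> - ereal (expectation f)"
      using elim(1) by (simp add: sum_negf)
    then have "ereal (expectation f) \<le> liminf ?X"
      using ereal_Limsup_uminus[of sequentially ?X] by (simp add: ereal_uminus_le_reorder)
    then show ?case
      using elim(2) by (intro limsup_le_liminf_real)
  qed
qed

end

section \<open>Change of variables along a branch\<close>

lemma nn_integral_lborel_fst_snd:
  fixes F :: "real \<times> real \<Rightarrow> ennreal"
  assumes "F \<in> borel_measurable borel"
  shows "(\<integral>\<^sup>+z. F z \<partial>lborel) = (\<integral>\<^sup>+x. \<integral>\<^sup>+y. F (x, y) \<partial>lborel \<partial>lborel)"
  using assms by (subst lborel_prod[symmetric], subst lborel.nn_integral_fst[symmetric])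
    (auto simp: lborel_prod)

lemma nn_integral_lborel_swap:
  fixes F :: "real \<times> real \<Rightarrow> ennreal"
  assumes "F \<in> borel_measurable borel"
  shows "(\<integral>\<^sup>+x. \<integral>\<^sup>+y. F (x, y) \<partial>lborel \<partial>lborel) = (\<integral>\<^sup>+y. \<integral>\<^sup>+x. F (x, y) \<partial>lborel \<partial>lborel)"
proof -
  have "F \<in> borel_measurable (lborel \<Otimes>\<^sub>M lborel)"
    using assms by (simp add: lborel_prod)
  then show ?thesis
    by (intro lborel_pair.Fubini'[symmetric]) simp
qed

lemma fst_borel [measurable]: "(fst :: real \<times> real \<Rightarrow> real) \<in> borel_measurable borel"
  by (intro borel_measurable_continuous_onI continuous_intros)

lemma snd_borel [measurable]: "(snd :: real \<times> real \<Rightarrow> real) \<in> borel_measurable borel"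
  by (intro borel_measurable_continuous_onI continuous_intros)

lemma open_triangle_borel [measurable]: "open_triangle \<in> sets borel"
proof -
  have "open_triangle = {z. 0 < snd z \<and> snd z < fst z \<and> fst z < 1}"
    by (auto simp: open_triangle_def)
  also have "\<dots> \<in> sets borel" by measurable
  finally show ?thesis .
qed

lemma subtriangle_borel [measurable]: "subtriangle k \<in> sets borel"
proof -
  have "subtriangle k = {z. 0 < fst z \<and> snd z < fst z \<and> real k * snd z + fst z < 1 \<and> 1 < (real k + 1) * snd z + fst z}"
    by (auto simp: mem_subtriangle_iff)
  also have "\<dots> \<in> sets borel" by measurable
  finally show ?thesis .
qed

lemma S_map_measurable [measurable]: "S_map k \<in> borel_measurable borel"
proof -
  have "S_map k = (\<lambda>z. (1 / (real k * fst z + fst z - snd z + 1), fst z / (real k * fst z + fst z - snd z + 1)))"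
    by (auto simp: S_map_def)
  also have "\<dots> \<in> borel_measurable borel" by measurable
  finally show ?thesis .
qed

text \<open>
  The change of variables formula for the branch \<open>S_map k\<close>, whose Jacobian is the cube of its first
  coordinate. With \<open>(x, y) = S_map k (t, v)\<close> one has \<open>y = x * t\<close> and \<open>x = 1 / (c - v)\<close>, where \<open>c\<close>
  depends on \<open>t\<close> only. Hence the two-dimensional substitution is a linear one in \<open>y\<close> for fixed \<open>x\<close>,
  with factor \<open>x\<close>, followed by one in \<open>x\<close> for fixed \<open>t\<close>, with factor \<open>x\<^sup>2\<close>.
\<close>

lemma nn_integral_subtriangle:
  fixes F :: "real \<times> real \<Rightarrow> ennreal"
  assumes [measurable]: "F \<in> borel_measurable borel"
  shows "(\<integral>\<^sup>+z\<in>subtriangle k. F z \<partial>lborel) =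
    (\<integral>\<^sup>+u\<in>open_triangle. (F (S_map k u) * ennreal (fst (S_map k u) ^ 3)) \<partial>lborel)"
proof -
  define G where "G z = F z * indicator (subtriangle k) z" for z
  define H where "H = (\<lambda>(x, t). ennreal x * G (x, x * t))"
  define R where "R u = F (S_map k u) * ennreal (fst (S_map k u) ^ 3) * indicator open_triangle u" for u
  have [measurable]: "G \<in> borel_measurable borel" unfolding G_def by simp
  have "H = (\<lambda>z. ennreal (fst z) * G (fst z, fst z * snd z))" by (auto simp: H_def)
  also have "\<dots> \<in> borel_measurable borel" by measurable
  finally have [measurable]: "H \<in> borel_measurable borel" .
  have [measurable]: "R \<in> borel_measurable borel" unfolding R_def by simp
  have 1: "(\<integral>\<^sup>+y. G (x, y) \<partial>lborel) = (\<integral>\<^sup>+t. H (x, t) \<partial>lborel)" for x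
  proof (cases "0 < x")
    case True
    have "(\<integral>\<^sup>+y. G (x, y) \<partial>lborel) = ennreal x * (\<integral>\<^sup>+t. G (x, 0 + x * t) \<partial>lborel)"
      using True by (subst nn_integral_real_affine[where c = x and t = 0]) auto
    then show ?thesis by (simp add: H_def nn_integral_cmult)
  next
    case False
    then show ?thesis by (simp add: H_def G_def mem_subtriangle_iff ennreal_neg)
  qed
  have 2: "(\<integral>\<^sup>+x. H (x, t) \<partial>lborel) = (\<integral>\<^sup>+v. R (t, v) \<partial>lborel)" for t
  proof (cases "0 < t \<and> t < 1")
    case False
    have "(x, x * t) \<notin> subtriangle k" for x
    proof
      assume "(x, x * t) \<in> subtriangle k"
      then have "0 < x * t" "x * t < x"
        using subtriangle_subset[of k] by (auto simp: open_triangle_def)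
      then show False using False by (auto simp: zero_less_mult_iff)
    qed
    then have "H (x, t) = 0" for x
      by (simp add: H_def G_def)
    moreover have "R (t, v) = 0" for v
      using False by (auto simp: R_def open_triangle_def indicator_def)
    ultimately show ?thesis by simp
  next
    case t: True
    define c where "c = real k * t + t + 1"
    have kt: "0 \<le> real k * t" using t by simp
    define g where "g v = 1 / (c - v)" for v
    have pos: "0 < c - v" if "v \<le> t" for v
      using that kt by (simp add: c_def)
    have mem: "(g v, g v * t) \<in> subtriangle k \<longleftrightarrow> 0 < v \<and> v < t" if "v \<le> t" for v
      unfolding mem_subtriangle_iff using pos[OF that] t
      by (simp add: g_def divide_simps) (auto simp: c_def algebra_simps)
    have supp: "H (x, t) = H (x, t) * indicator {g 0..g t} x" for x
    proof (cases "(x, x * t) \<in> subtriangle k")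
      case True
      then have x: "0 < x" "real k * (x * t) + x < 1" "1 < (real k + 1) * (x * t) + x"
        by (auto simp: mem_subtriangle_iff)
      have "x \<in> {g 0..g t}"
        using x pos[of 0] pos[of t] t by (simp add: g_def divide_simps) (simp add: c_def algebra_simps)
      then show ?thesis by simp
    qed (simp add: H_def G_def)
    have "(\<integral>\<^sup>+x. H (x, t) \<partial>lborel) = (\<integral>\<^sup>+x. H (x, t) * indicator {g 0..g t} x \<partial>lborel)"
      using supp by simp
    also have "\<dots> = (\<integral>\<^sup>+v. H (g v, t) * ennreal ((g v)\<^sup>2) * indicator {0..t} v \<partial>lborel)"
    proof (rule nn_integral_substitution_aux)
      show "(g has_real_derivative (g v)\<^sup>2) (at v)" if "v \<in> {0..t}" for v
        unfolding g_def using pos[of v] that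
        by (auto intro!: derivative_eq_intros simp: power2_eq_square divide_simps)
      show "continuous_on {0..t} (\<lambda>v. (g v)\<^sup>2)"
        unfolding g_def using pos by (intro continuous_intros) force
    qed (use t in auto)
    also have "\<dots> = (\<integral>\<^sup>+v. R (t, v) \<partial>lborel)"
    proof (rule nn_integral_cong)
      fix v
      have S: "S_map k (t, v) = (g v, g v * t)"
        by (simp add: S_map_def g_def c_def algebra_simps)
      show "H (g v, t) * ennreal ((g v)\<^sup>2) * indicator {0..t} v = R (t, v)"
      proof (cases "0 < v \<and> v < t")
        case True
        then have "0 < g v" using pos[of v] by (simp add: g_def)
        then have "ennreal (g v) * ennreal ((g v)\<^sup>2) = ennreal (g v ^ 3)"
          by (simp add: ennreal_mult[symmetric] power3_eq_cube power2_eq_square mult.assoc)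
        have "R (t, v) = F (g v, g v * t) * (ennreal (g v) * ennreal ((g v)\<^sup>2))"
          using True t \<open>ennreal (g v) * ennreal ((g v)\<^sup>2) = ennreal (g v ^ 3)\<close>
          by (simp add: R_def S open_triangle_def)
        moreover have "H (g v, t) = ennreal (g v) * F (g v, g v * t)"
          using True mem[of v] by (simp add: H_def G_def)
        ultimately show ?thesis using True by (simp add: mult_ac)
      next
        case False
        then show ?thesis using mem[of v]
          by (auto simp: R_def H_def G_def open_triangle_def indicator_def)
      qed
    qed
    finally show ?thesis .
  qed
  have "(\<integral>\<^sup>+z\<in>subtriangle k. F z \<partial>lborel) = (\<integral>\<^sup>+x. \<integral>\<^sup>+y. G (x, y) \<partial>lborel \<partial>lborel)"
    unfolding G_def[symmetric] by (rule nn_integral_lborel_fst_snd) simp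
  also have "\<dots> = (\<integral>\<^sup>+t. \<integral>\<^sup>+x. H (x, t) \<partial>lborel \<partial>lborel)"
    unfolding 1 by (rule nn_integral_lborel_swap) simp
  also have "\<dots> = (\<integral>\<^sup>+t. \<integral>\<^sup>+v. R (t, v) \<partial>lborel \<partial>lborel)"
    by (simp add: 2)
  also have "\<dots> = (\<integral>\<^sup>+u. R u \<partial>lborel)"
    by (rule nn_integral_lborel_fst_snd[symmetric]) simp
  finally show ?thesis by (simp add: R_def)
qed

text \<open>
  The part of the triangle outside the subtriangles lies on the countably many lines
  \<open>x + k * y = 1\<close>.
\<close>

lemma AE_subtriangles: "AE z in lborel. z \<in> open_triangle \<longrightarrow> z \<in> (\<Union>k. subtriangle k)"
proof -
  have "negligible {z :: real \<times> real. (1::real, real k) \<bullet> z = 1}" for k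
    by (intro negligible_hyperplane) (simp add: zero_prod_def)
  then have "AE z in lebesgue. z \<notin> {z :: real \<times> real. (1::real, real k) \<bullet> z = 1}" for k
    unfolding negligible_iff_null_sets by (rule AE_not_in)
  then have "AE z in lebesgue. \<forall>k. (1::real, real k) \<bullet> z \<noteq> (1::real)"
    by (simp add: AE_all_countable)
  then have "AE z in lborel. \<forall>k. (1::real, real k) \<bullet> z \<noteq> (1::real)"
    by (simp add: AE_completion_iff)
  then show ?thesis
  proof eventually_elim
    case (elim z)
    obtain x y where z: "z = (x, y)" by (cases z)
    show ?case
    proof
      assume "z \<in> open_triangle"
      then have xy: "0 < y" "y < x" "x < 1" by (auto simp: z open_triangle_def)
      define k where "k = nat \<lfloor>(1 - x) / y\<rfloor>"
      have "0 \<le> (1 - x) / y" using xy by simp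
      then have "real k \<le> (1 - x) / y" "(1 - x) / y < real k + 1"
        unfolding k_def by linarith+
      then have "real k * y \<le> 1 - x" "1 - x < (real k + 1) * y"
        using xy by (simp_all add: field_simps)
      moreover have "real k * y + x \<noteq> 1" using elim[rule_format, of k] by (simp add: z)
      ultimately have "z \<in> subtriangle k" using xy by (simp add: z mem_subtriangle_iff)
      then show "z \<in> (\<Union>k. subtriangle k)" by blast
    qed
  qed
qed

section \<open>The invariant measure\<close>

text \<open>
  The constants \<open>first_digit\<close> and \<open>T_map\<close> are given by choice operators. The two functions below agree
  with them on the subtriangles and are given by formulas on the whole plane, which makes them Borel
  measurable and lets the plane serve as the underlying space.
\<close>

definition triangle_digit :: "real \<times> real \<Rightarrow> nat" where
  "triangle_digit z = nat \<lfloor>(1 - fst z) / snd z\<rfloor>"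

definition triangle_step :: "real \<times> real \<Rightarrow> real \<times> real" where
  "triangle_step z =
    (snd z / fst z, (fst z + real (triangle_digit z) * snd z + snd z - 1) / fst z)"

lemma triangle_digit_measurable [measurable]:
  "triangle_digit \<in> measurable borel (count_space UNIV)"
  unfolding triangle_digit_def by measurable

lemma triangle_step_measurable [measurable]: "triangle_step \<in> borel_measurable borel"
  unfolding triangle_step_def by measurable

lemma triangle_digit_eq:
  assumes "z \<in> subtriangle k"
  shows "triangle_digit z = k"
proof -
  obtain x y where z: "z = (x, y)" by (cases z)
  have "z \<in> open_triangle" using assms subtriangle_subset by blast
  then have y: "0 < y" by (simp add: z open_triangle_def)
  have "real k * y + x < 1" "1 < (real k + 1) * y + x"
    using assms by (simp_all add: z mem_subtriangle_iff)
  with y have "real k \<le> (1 - x) / y" "(1 - x) / y < real k + 1"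
    by (simp_all add: field_simps)
  then have "\<lfloor>(1 - x) / y\<rfloor> = int k"
    by (intro floor_unique) auto
  then show ?thesis by (simp add: triangle_digit_def z)
qed

lemma triangle_step_eq_T_map:
  assumes "z \<in> subtriangle k"
  shows "triangle_step z = T_map z"
  using assms T_map_eq[of "fst z" "snd z" k] by (simp add: triangle_step_def triangle_digit_eq)

lemma triangle_step_S_map:
  assumes "u \<in> open_triangle"
  shows "triangle_step (S_map k u) = u"
proof -
  have m: "S_map k u \<in> subtriangle k" using assms by (simp add: subtriangle_def)
  show ?thesis
    unfolding triangle_step_eq_T_map[OF m] T_map_def first_digit_eq[OF m]
    by (rule inv_into_f_f[OF inj_on_S_map assms])
qed

lemma S_map_triangle_step:
  assumes "z \<in> subtriangle k"
  shows "triangle_step z \<in> open_triangle" "S_map k (triangle_step z) = z"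
  using assms triangle_step_S_map by (auto simp: subtriangle_def)

definition invariant_density :: "real \<times> real \<Rightarrow> real" where
  "invariant_density z = 6 / (pi\<^sup>2 * fst z * (1 - snd z))"

lemma invariant_density_measurable [measurable]: "invariant_density \<in> borel_measurable borel"
  unfolding invariant_density_def by measurable

definition invariant_measure :: "(real \<times> real) measure" where
  "invariant_measure =
    density lborel (\<lambda>z. ennreal (invariant_density z) * indicator open_triangle z)"

lemma sets_invariant_measure [simp, measurable_cong]: "sets invariant_measure = sets borel"
  by (simp add: invariant_measure_def)

lemma space_invariant_measure [simp]: "space invariant_measure = UNIV"
  by (simp add: invariant_measure_def)

lemma nn_integral_invariant_measure:
  assumes "F \<in> borel_measurable borel"
  shows "(\<integral>\<^sup>+z. F z \<partial>invariant_measure) =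
    (\<integral>\<^sup>+z\<in>open_triangle. (F z * ennreal (invariant_density z)) \<partial>lborel)"
  using assms unfolding invariant_measure_def
  by (subst nn_integral_density) (auto simp: mult_ac)

text \<open>
  The density is a fixed point of the transfer operator. Writing \<open>e k = k * a + 1 - b\<close>, the term of
  index \<open>k\<close> is \<open>6 / (pi\<^sup>2 * e k * e (Suc k))\<close>, and since \<open>e (Suc k) - e k = a\<close> the series telescopes.
\<close>

lemma transfer_invariant_density:
  assumes "u \<in> open_triangle"
  shows "(\<Sum>k. ennreal (invariant_density (S_map k u) * fst (S_map k u) ^ 3)) = ennreal (invariant_density u)"
proof (rule suminf_ennreal_eq)
  obtain a b where u: "u = (a, b)" by (cases u)
  have ab: "0 < b" "b < a" "a < 1" using assms by (auto simp: u open_triangle_def)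
  define e where "e k = real k * a + 1 - b" for k
  have e: "0 < e k" for k
  proof -
    have "0 \<le> real k * a" using ab by simp
    then show ?thesis using ab unfolding e_def by linarith
  qed
  have e_Suc: "real k * a + a - b + 1 = e (Suc k)" "e (Suc k) - a = e k" for k
    by (simp_all add: e_def algebra_simps)
  have term_eq: "invariant_density (S_map k u) * fst (S_map k u) ^ 3 =
      6 / (pi\<^sup>2 * a) * (1 / e k) - 6 / (pi\<^sup>2 * a) * (1 / e (Suc k))" for k
  proof -
    have "1 - a / e (Suc k) = e k / e (Suc k)"
      using e[of "Suc k"] e_Suc(2)[of k] by (simp add: field_simps)
    then have "invariant_density (S_map k u) * fst (S_map k u) ^ 3 = 6 / (pi\<^sup>2 * (e k * e (Suc k)))"
      using e[of k] e[of "Suc k"]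
      by (simp add: invariant_density_def S_map_def u e_Suc(1) power3_eq_cube)
    also have "\<dots> = 6 / (pi\<^sup>2 * a) * ((e (Suc k) - e k) / (e k * e (Suc k)))"
    proof -
      have "e (Suc k) - e k = a" using e_Suc(2)[of k] by simp
      then show ?thesis using ab e[of k] e[of "Suc k"] by simp
    qed
    also have "(e (Suc k) - e k) / (e k * e (Suc k)) = 1 / e k - 1 / e (Suc k)"
      using e[of k] e[of "Suc k"] by (simp add: field_simps)
    finally show ?thesis by (simp add: right_diff_distrib)
  qed
  show "0 \<le> invariant_density (S_map k u) * fst (S_map k u) ^ 3" for k
  proof -
    have "e k \<le> e (Suc k)" using ab by (simp add: e_def algebra_simps)
    then have "1 / e (Suc k) \<le> 1 / e k" using e by (simp add: frac_le)
    then show ?thesis unfolding term_eq using ab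
      by (simp only: right_diff_distrib[symmetric]) (simp add: mult_nonneg_nonneg)
  qed
  have "filterlim e at_top sequentially"
    unfolding e_def using ab by real_asymp
  then have "(\<lambda>k. 6 / (pi\<^sup>2 * a) * (1 / e k)) \<longlonglongrightarrow> 6 / (pi\<^sup>2 * a) * 0"
    by (intro tendsto_mult tendsto_const tendsto_divide_0[OF tendsto_const] filterlim_at_top_imp_at_infinity)
  then have "(\<lambda>k. 6 / (pi\<^sup>2 * a) * (1 / e k) - 6 / (pi\<^sup>2 * a) * (1 / e (Suc k))) sums
      (6 / (pi\<^sup>2 * a) * (1 / e 0) - 6 / (pi\<^sup>2 * a) * 0)"
    by (rule telescope_sums')
  then show "(\<lambda>k. invariant_density (S_map k u) * fst (S_map k u) ^ 3) sums invariant_density u"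
    unfolding term_eq by (simp add: invariant_density_def u e_def)
qed

text \<open>
  Split the triangle into the subtriangles, pull each one back to the full triangle along its branch
  and sum the resulting densities.
\<close>

lemma nn_integral_triangle_step:
  fixes F :: "real \<times> real \<Rightarrow> ennreal"
  assumes [measurable]: "F \<in> borel_measurable borel"
  shows "(\<integral>\<^sup>+z. F (triangle_step z) \<partial>invariant_measure) = (\<integral>\<^sup>+z. F z \<partial>invariant_measure)"
proof -
  let ?h = "\<lambda>z. ennreal (invariant_density z)"
  have "(\<integral>\<^sup>+z. F (triangle_step z) \<partial>invariant_measure) =
      (\<integral>\<^sup>+z\<in>open_triangle. (F (triangle_step z) * ?h z) \<partial>lborel)"
    by (rule nn_integral_invariant_measure) simp
  also have "\<dots> = (\<integral>\<^sup>+z\<in>(\<Union>k. subtriangle k). (F (triangle_step z) * ?h z) \<partial>lborel)"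
    using AE_subtriangles subtriangle_subset
    by (intro nn_integral_cong_AE) (auto elim!: eventually_mono simp: indicator_def)
  also have "\<dots> = (\<Sum>k. \<integral>\<^sup>+z\<in>subtriangle k. (F (triangle_step z) * ?h z) \<partial>lborel)"
    using subtriangle_disjoint
    by (intro nn_integral_disjoint_family) (auto simp: disjoint_family_on_def)
  also have "\<dots> = (\<Sum>k. \<integral>\<^sup>+u\<in>open_triangle. (F u * (?h (S_map k u) * ennreal (fst (S_map k u) ^ 3))) \<partial>lborel)"
    by (subst nn_integral_subtriangle, simp, intro arg_cong[where f = suminf] ext nn_integral_cong)
      (auto simp: indicator_def triangle_step_S_map mult_ac)
  also have "\<dots> = (\<integral>\<^sup>+u. (\<Sum>k. F u * (?h (S_map k u) * ennreal (fst (S_map k u) ^ 3)) * indicator open_triangle u) \<partial>lborel)"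
    by (rule nn_integral_suminf[symmetric]) simp
  also have "\<dots> = (\<integral>\<^sup>+u\<in>open_triangle. (F u * ?h u) \<partial>lborel)"
  proof (intro nn_integral_cong)
    fix u :: "real \<times> real"
    show "(\<Sum>k. F u * (?h (S_map k u) * ennreal (fst (S_map k u) ^ 3)) * indicator open_triangle u) =
        F u * ?h u * indicator open_triangle u"
    proof (cases "u \<in> open_triangle")
      case True
      have "0 \<le> fst (S_map k u)" for k
      proof -
        have "S_map k u \<in> subtriangle k" using True by (simp add: subtriangle_def)
        then show ?thesis using mem_subtriangle_iff[of "fst (S_map k u)" "snd (S_map k u)" k] by simp
      qed
      then have "?h (S_map k u) * ennreal (fst (S_map k u) ^ 3) =
          ennreal (invariant_density (S_map k u) * fst (S_map k u) ^ 3)" for k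
        by (simp add: ennreal_mult'')
      then show ?thesis using True transfer_invariant_density[OF True]
        by simp
    qed simp
  qed
  also have "\<dots> = (\<integral>\<^sup>+z. F z \<partial>invariant_measure)"
    by (rule nn_integral_invariant_measure[symmetric]) simp
  finally show ?thesis .
qed

lemma distr_triangle_step: "distr invariant_measure invariant_measure triangle_step = invariant_measure"
proof (rule measure_eqI)
  fix A assume "A \<in> sets (distr invariant_measure invariant_measure triangle_step)"
  then have [measurable]: "A \<in> sets borel" by simp
  have "emeasure (distr invariant_measure invariant_measure triangle_step) A =
      (\<integral>\<^sup>+z. indicator A z \<partial>distr invariant_measure invariant_measure triangle_step)"
    by (rule nn_integral_indicator[symmetric]) simp
  also have "\<dots> = (\<integral>\<^sup>+z. indicator A (triangle_step z) \<partial>invariant_measure)"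
    by (rule nn_integral_distr) auto
  also have "\<dots> = (\<integral>\<^sup>+z. indicator A z \<partial>invariant_measure)"
    by (rule nn_integral_triangle_step) simp
  also have "\<dots> = emeasure invariant_measure A" by simp
  finally show "emeasure (distr invariant_measure invariant_measure triangle_step) A =
    emeasure invariant_measure A" .
qed simp

lemma nn_integral_power:
  fixes a :: real
  assumes "0 \<le> a"
  shows "(\<integral>\<^sup>+x\<in>{0<..<a}. ennreal (x ^ n) \<partial>lborel) = ennreal (a ^ Suc n / real (Suc n))"
proof -
  have "(\<integral>\<^sup>+x\<in>{0<..<a}. ennreal (x ^ n) \<partial>lborel) = (\<integral>\<^sup>+x. ennreal (x ^ n) * indicator {0..a} x \<partial>lborel)"
    using AE_lborel_singleton[of 0] AE_lborel_singleton[of a]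
    by (intro nn_integral_cong_AE, eventually_elim) (auto simp: indicator_def)
  also have "\<dots> = ennreal (a ^ Suc n / real (Suc n) - 0 ^ Suc n / real (Suc n))"
  proof (rule nn_integral_FTC_Icc)
    show "((\<lambda>x. x ^ Suc n / real (Suc n)) has_real_derivative x ^ n) (at x)" for x
      by (rule derivative_eq_intros refl | simp)+
  qed (use assms in auto)
  finally show ?thesis by simp
qed

text \<open>
  Expand \<open>1 / (1 - y)\<close> into a geometric series. Integrating \<open>y ^ n / x\<close> over the triangle gives
  \<open>1 / (n + 1)\<^sup>2\<close>, and these numbers add up to \<open>pi\<^sup>2 / 6\<close>.
\<close>

lemma emeasure_invariant_measure_UNIV: "emeasure invariant_measure UNIV = 1"
proof -
  let ?c = "6 / pi\<^sup>2 :: real"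
  have "emeasure invariant_measure UNIV = (\<integral>\<^sup>+z. 1 \<partial>invariant_measure)"
    by simp
  also have "\<dots> = (\<integral>\<^sup>+z\<in>open_triangle. (1 * ennreal (invariant_density z)) \<partial>lborel)"
    by (rule nn_integral_invariant_measure) simp
  also have "\<dots> = (\<integral>\<^sup>+z. (\<Sum>n. ennreal (?c * snd z ^ n / fst z) * indicator open_triangle z) \<partial>lborel)"
  proof (intro nn_integral_cong)
    fix z :: "real \<times> real"
    show "1 * ennreal (invariant_density z) * indicator open_triangle z =
      (\<Sum>n. ennreal (?c * snd z ^ n / fst z) * indicator open_triangle z)"
    proof (cases "z \<in> open_triangle")
      case True
      then have z: "0 < snd z" "snd z < fst z" "fst z < 1" by (auto simp: open_triangle_def)
      then have "(\<lambda>n. ?c / fst z * snd z ^ n) sums (?c / fst z * (1 / (1 - snd z)))"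
        by (intro sums_mult geometric_sums) auto
      then have "(\<lambda>n. ?c * snd z ^ n / fst z) sums invariant_density z"
        by (simp add: invariant_density_def field_simps)
      then have "(\<Sum>n. ennreal (?c * snd z ^ n / fst z)) = ennreal (invariant_density z)"
        using z by (intro suminf_ennreal_eq) auto
      then show ?thesis using True by simp
    qed simp
  qed
  also have "\<dots> = (\<Sum>n. \<integral>\<^sup>+z. ennreal (?c * snd z ^ n / fst z) * indicator open_triangle z \<partial>lborel)"
    by (rule nn_integral_suminf) simp
  also have "\<dots> = (\<Sum>n. ennreal (?c * (1 / (real n + 1)\<^sup>2)))"
  proof (intro arg_cong[where f = suminf] ext)
    fix n
    have "(\<integral>\<^sup>+z. ennreal (?c * snd z ^ n / fst z) * indicator open_triangle z \<partial>lborel) =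
        (\<integral>\<^sup>+x. \<integral>\<^sup>+y. ennreal (?c * y ^ n / x) * indicator open_triangle (x, y) \<partial>lborel \<partial>lborel)"
      by (subst nn_integral_lborel_fst_snd) auto
    also have "\<dots> = (\<integral>\<^sup>+x. ennreal (?c / real (Suc n)) * (ennreal (x ^ n) * indicator {0<..<1} x) \<partial>lborel)"
    proof (intro nn_integral_cong)
      fix x :: real
      show "(\<integral>\<^sup>+y. ennreal (?c * y ^ n / x) * indicator open_triangle (x, y) \<partial>lborel) =
        ennreal (?c / real (Suc n)) * (ennreal (x ^ n) * indicator {0<..<1} x)"
      proof (cases "0 < x \<and> x < 1")
        case True
        have "(\<integral>\<^sup>+y. ennreal (?c * y ^ n / x) * indicator open_triangle (x, y) \<partial>lborel) =
            (\<integral>\<^sup>+y. ennreal (?c / x) * (ennreal (y ^ n) * indicator {0<..<x} y) \<partial>lborel)"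
          using True
          by (intro nn_integral_cong) (auto simp: indicator_def open_triangle_def ennreal_mult'[symmetric])
        also have "\<dots> = ennreal (?c / x) * ennreal (x ^ Suc n / real (Suc n))"
          using True nn_integral_power[of x n] by (subst nn_integral_cmult) auto
        also have "\<dots> = ennreal (?c / real (Suc n) * x ^ n)"
          using True by (simp add: ennreal_mult'[symmetric])
        also have "\<dots> = ennreal (?c / real (Suc n)) * ennreal (x ^ n)"
          using True by (intro ennreal_mult) auto
        finally show ?thesis using True by simp
      next
        case False
        then have "indicator open_triangle (x, y) = (0 :: ennreal)" for y
          by (auto simp: indicator_def open_triangle_def)
        then show ?thesis using False by simp
      qed
    qed
    also have "\<dots> = ennreal (?c / real (Suc n)) * ennreal (1 / real (Suc n))"
      using nn_integral_power[of 1 n] by (subst nn_integral_cmult) auto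
    also have "\<dots> = ennreal (?c * (1 / (real n + 1)\<^sup>2))"
      by (simp add: ennreal_mult'[symmetric] power2_eq_square add.commute)
    finally show "(\<integral>\<^sup>+z. ennreal (?c * snd z ^ n / fst z) * indicator open_triangle z \<partial>lborel) =
      ennreal (?c * (1 / (real n + 1)\<^sup>2))" .
  qed
  also have "\<dots> = ennreal (?c * (pi\<^sup>2 / 6))"
    using inverse_squares_sums by (intro suminf_ennreal_eq sums_mult) (auto simp: add.commute)
  finally show ?thesis by simp
qed

interpretation triangle: measure_preserving invariant_measure triangle_step
  by (intro measure_preserving.intro prob_spaceI measure_preserving_axioms.intro)
    (simp_all add: emeasure_invariant_measure_UNIV distr_triangle_step)

lemma AE_invariant_measure_iff:
  "(AE z in invariant_measure. P z) \<longleftrightarrow> (AE z in lborel. z \<in> open_triangle \<longrightarrow> P z)"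
proof -
  have "0 < invariant_density z" if "z \<in> open_triangle" for z
    using that by (auto simp: open_triangle_def invariant_density_def)
  then have "0 < ennreal (invariant_density z) * indicator open_triangle z \<longleftrightarrow> z \<in> open_triangle" for z
    by (auto simp: indicator_def)
  then show ?thesis
    unfolding invariant_measure_def by (subst AE_density) auto
qed

section \<open>Homogeneous coordinates\<close>

text \<open>
  A triple \<open>(a, b, c)\<close> of nonnegative numbers represents the point with homogeneous coordinates
  \<open>[a + b + c : b + c : c]\<close>, so the closed triangle is the projectivized nonnegative orthant. In these
  coordinates the branches become linear maps with nonnegative coefficients, and compositions of
  branches are handled by linear algebra instead of continued fractions.
\<close>

type_synonym triple = "real \<times> real \<times> real"

definition weight :: "triple \<Rightarrow> real" where
  "weight d = fst d + fst (snd d) + snd (snd d)"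

definition nonneg :: "triple \<Rightarrow> bool" where
  "nonneg d \<longleftrightarrow> 0 \<le> fst d \<and> 0 \<le> fst (snd d) \<and> 0 \<le> snd (snd d)"

definition ones :: triple where
  "ones = (1, 1, 1)"

definition numerators :: "triple \<Rightarrow> real \<times> real" where
  "numerators d = (fst (snd d) + snd (snd d), snd (snd d))"

definition project :: "triple \<Rightarrow> real \<times> real" where
  "project d = (1 / weight d) *\<^sub>R numerators d"

definition homogenize :: "real \<times> real \<Rightarrow> triple" where
  "homogenize = (\<lambda>(x, y). (1 - x, x - y, y))"

definition vec_step :: "nat \<Rightarrow> triple \<Rightarrow> triple" where
  "vec_step k = (\<lambda>(a, b, c). (b + real k * (b + c), a, b + c))"

primrec vec_word :: "nat list \<Rightarrow> triple \<Rightarrow> triple" where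
  "vec_word [] d = d"
| "vec_word (k # w) d = vec_step k (vec_word w d)"

primrec S_word :: "nat list \<Rightarrow> real \<times> real \<Rightarrow> real \<times> real" where
  "S_word [] z = z"
| "S_word (k # w) z = S_map k (S_word w z)"

lemma vec_word_append: "vec_word (v @ w) d = vec_word v (vec_word w d)"
  by (induction v) auto

lemma S_word_append: "S_word (v @ w) z = S_word v (S_word w z)"
  by (induction v) auto

lemma linear_weight: "linear weight"
  by (rule linearI) (auto simp: weight_def algebra_simps split: prod.splits)

lemma linear_numerators: "linear numerators"
  by (rule linearI) (auto simp: numerators_def algebra_simps split: prod.splits)

lemma linear_vec_step: "linear (vec_step k)"
  by (rule linearI) (auto simp: vec_step_def algebra_simps split: prod.splits)

lemma linear_vec_word: "linear (vec_word w)"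
proof (induction w)
  case Nil
  show ?case by (rule linearI) auto
next
  case (Cons k w)
  have "vec_word (k # w) = vec_step k \<circ> vec_word w" by auto
  then show ?case using linear_compose[OF Cons linear_vec_step] by (simp only:)
qed

lemma nonneg_ones: "nonneg ones" and weight_ones: "weight ones = 3"
  by (simp_all add: nonneg_def weight_def ones_def)

lemma nonneg_vec_step: "nonneg d \<Longrightarrow> nonneg (vec_step k d)"
  by (auto simp: nonneg_def vec_step_def split: prod.splits)

lemma nonneg_vec_word: "nonneg d \<Longrightarrow> nonneg (vec_word w d)"
  by (induction w) (auto intro: nonneg_vec_step)

lemma weight_nonneg: "nonneg d \<Longrightarrow> 0 \<le> weight d"
  by (auto simp: nonneg_def weight_def)

lemma weight_vec_step: "nonneg d \<Longrightarrow> weight d \<le> weight (vec_step k d)"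
  by (auto simp: nonneg_def weight_def vec_step_def split: prod.splits)

lemma weight_vec_word: "nonneg d \<Longrightarrow> weight d \<le> weight (vec_word w d)"
proof (induction w)
  case (Cons k w)
  then show ?case
    using weight_vec_step[OF nonneg_vec_word[OF Cons.prems], of w k] by simp
qed simp

lemma nonneg_scale: "nonneg d \<Longrightarrow> 0 \<le> r \<Longrightarrow> nonneg (r *\<^sub>R d)"
  by (auto simp: nonneg_def split: prod.splits)

lemma nonneg_add: "nonneg d \<Longrightarrow> nonneg e \<Longrightarrow> nonneg (d + e)"
  by (auto simp: nonneg_def split: prod.splits)

lemma nonneg_homogenize: "z \<in> open_triangle \<Longrightarrow> nonneg (homogenize z)"
  by (auto simp: open_triangle_def nonneg_def homogenize_def)

lemma weight_homogenize: "weight (homogenize z) = 1"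
  by (auto simp: weight_def homogenize_def split: prod.splits)

lemma project_homogenize: "project (homogenize z) = z"
  unfolding project_def weight_homogenize by (auto simp: numerators_def homogenize_def split: prod.splits)

text \<open>
  The second equation identifies the Jacobian of a branch: along a composition of branches the ratios
  \<open>weight d / weight (vec_step k d)\<close> multiply to a single inverse weight.
\<close>

lemma S_map_project:
  assumes "nonneg d" "0 < weight d"
  shows "S_map k (project d) = project (vec_step k d)"
    "fst (S_map k (project d)) = weight d / weight (vec_step k d)"
proof -
  obtain a b c where d: "d = (a, b, c)" by (cases d)
  define s s' where "s = weight d" and "s' = weight (vec_step k d)"
  have s: "0 < s" "0 < s'"
    using assms weight_vec_step[OF assms(1), of k] by (auto simp: s_def s'_def)
  have "real k * ((b + c) / s) + (b + c) / s - c / s + 1 = s' / s"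
    using s by (simp add: field_simps) (simp add: s_def s'_def d weight_def vec_step_def algebra_simps)
  then have S: "S_map k (project d) = (s / s', (b + c) / s')"
    using s by (simp add: S_map_def project_def d numerators_def flip: s_def[unfolded d])
  have "project (vec_step k d) = (s / s', (b + c) / s')"
    unfolding project_def s'_def[symmetric]
    by (simp add: numerators_def d vec_step_def s_def weight_def add.assoc)
  with S show "S_map k (project d) = project (vec_step k d)" by simp
  show "fst (S_map k (project d)) = weight d / weight (vec_step k d)"
    unfolding S by (simp add: s_def s'_def)
qed

lemma S_word_project:
  assumes "z \<in> open_triangle"
  shows "S_word w z = project (vec_word w (homogenize z))"
proof (induction w)
  case Nil
  show ?case by (simp add: project_homogenize)
next
  case (Cons k w)
  have "nonneg (vec_word w (homogenize z))" "0 < weight (vec_word w (homogenize z))"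
    using nonneg_vec_word[OF nonneg_homogenize[OF assms], of w] weight_vec_word[OF nonneg_homogenize[OF assms], of w]
    by (auto simp: weight_homogenize)
  then show ?case by (simp add: Cons S_map_project)
qed

section \<open>Cylinders\<close>

definition cylinder :: "nat list \<Rightarrow> (real \<times> real) set" where
  "cylinder w = S_word w ` open_triangle"

lemma cylinder_Nil [simp]: "cylinder [] = open_triangle"
  by (auto simp: cylinder_def)

lemma S_word_in_triangle: "z \<in> open_triangle \<Longrightarrow> S_word w z \<in> open_triangle"
proof (induction w)
  case (Cons k w)
  then have "S_map k (S_word w z) \<in> subtriangle k" by (simp add: subtriangle_def)
  then show ?case using subtriangle_subset by auto
qed simp

lemma cylinder_subset: "cylinder w \<subseteq> open_triangle"
  by (auto simp: cylinder_def S_word_in_triangle)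

lemma cylinder_append_subset: "cylinder (v @ w) \<subseteq> cylinder v"
  by (auto simp: cylinder_def S_word_append intro!: imageI S_word_in_triangle)

lemma cylinder_Cons: "z \<in> cylinder (k # w) \<longleftrightarrow> z \<in> subtriangle k \<and> triangle_step z \<in> cylinder w"
proof
  assume "z \<in> cylinder (k # w)"
  then obtain u where u: "u \<in> open_triangle" "z = S_map k (S_word w u)"
    by (auto simp: cylinder_def)
  then show "z \<in> subtriangle k \<and> triangle_step z \<in> cylinder w"
    using S_word_in_triangle[OF u(1), of w] triangle_step_S_map[of "S_word w u" k]
    by (auto simp: cylinder_def subtriangle_def)
next
  assume "z \<in> subtriangle k \<and> triangle_step z \<in> cylinder w"
  moreover from this have "S_map k (triangle_step z) = z" by (intro S_map_triangle_step) auto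
  ultimately show "z \<in> cylinder (k # w)"
    by (auto simp: cylinder_def)
qed

lemma cylinder_borel [measurable]: "cylinder w \<in> sets borel"
proof (induction w)
  case (Cons k w)
  note [measurable] = Cons
  have "cylinder (k # w) = {z. z \<in> subtriangle k \<and> triangle_step z \<in> cylinder w}"
    using cylinder_Cons by blast
  also have "\<dots> \<in> sets borel" by measurable
  finally show ?case .
qed simp

lemma S_word_measurable [measurable]: "S_word w \<in> borel_measurable borel"
proof (induction w)
  case Nil
  have "S_word [] = (\<lambda>z. z)" by auto
  then show ?case by simp
next
  case (Cons k w)
  note [measurable] = Cons
  have "S_word (k # w) = (\<lambda>z. S_map k (S_word w z))" by auto
  then show ?case by simp
qed

lemma weight_vec_word_homogenize_measurable [measurable]:
  "(\<lambda>u. weight (vec_word w (homogenize u))) \<in> borel_measurable borel"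
proof -
  have "continuous_on UNIV weight" "continuous_on UNIV (vec_word w)"
    by (simp_all add: linear_continuous_on linear_conv_bounded_linear[symmetric] linear_weight linear_vec_word)
  moreover have "continuous_on UNIV homogenize"
    unfolding homogenize_def case_prod_unfold by (intro continuous_intros)
  ultimately have "continuous_on UNIV (weight \<circ> (vec_word w \<circ> homogenize))"
    by (metis continuous_on_compose continuous_on_subset subset_UNIV)
  then show ?thesis by (simp add: o_def borel_measurable_continuous_onI)
qed

lemma nn_integral_cylinder:
  fixes F :: "real \<times> real \<Rightarrow> ennreal"
  assumes "F \<in> borel_measurable borel"
  shows "(\<integral>\<^sup>+z\<in>cylinder w. F z \<partial>lborel) =
    (\<integral>\<^sup>+u\<in>open_triangle. (F (S_word w u) * ennreal (1 / weight (vec_word w (homogenize u)) ^ 3)) \<partial>lborel)"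
  using assms
proof (induction w arbitrary: F)
  case Nil
  then show ?case by (simp add: weight_homogenize)
next
  case (Cons k w)
  note [measurable] = Cons.prems
  define G where "G u = F (S_map k u) * ennreal (fst (S_map k u) ^ 3)" for u
  have [measurable]: "G \<in> borel_measurable borel" unfolding G_def by simp
  have "(\<integral>\<^sup>+z\<in>cylinder (k # w). F z \<partial>lborel) =
      (\<integral>\<^sup>+z\<in>subtriangle k. (F z * indicator (cylinder w) (triangle_step z)) \<partial>lborel)"
    by (intro nn_integral_cong) (auto simp: indicator_def cylinder_Cons)
  also have "\<dots> = (\<integral>\<^sup>+u\<in>open_triangle. (F (S_map k u) * indicator (cylinder w) (triangle_step (S_map k u)) *
      ennreal (fst (S_map k u) ^ 3)) \<partial>lborel)"
    by (rule nn_integral_subtriangle) simp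
  also have "\<dots> = (\<integral>\<^sup>+u\<in>cylinder w. G u \<partial>lborel)"
    using cylinder_subset[of w]
    by (intro nn_integral_cong) (auto simp: indicator_def triangle_step_S_map G_def)
  also have "\<dots> = (\<integral>\<^sup>+u\<in>open_triangle. (G (S_word w u) * ennreal (1 / weight (vec_word w (homogenize u)) ^ 3)) \<partial>lborel)"
    by (rule Cons.IH) simp
  also have "\<dots> = (\<integral>\<^sup>+u\<in>open_triangle. (F (S_word (k # w) u) *
      ennreal (1 / weight (vec_word (k # w) (homogenize u)) ^ 3)) \<partial>lborel)"
  proof (intro nn_integral_cong)
    fix u :: "real \<times> real"
    show "G (S_word w u) * ennreal (1 / weight (vec_word w (homogenize u)) ^ 3) * indicator open_triangle u =
      F (S_word (k # w) u) * ennreal (1 / weight (vec_word (k # w) (homogenize u)) ^ 3) * indicator open_triangle u"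
    proof (cases "u \<in> open_triangle")
      case u: True
      define d where "d = vec_word w (homogenize u)"
      have d: "nonneg d" "0 < weight d"
        using nonneg_vec_word[OF nonneg_homogenize[OF u], of w] weight_vec_word[OF nonneg_homogenize[OF u], of w]
        by (auto simp: weight_homogenize d_def)
      have d': "0 < weight (vec_step k d)"
        using weight_vec_step[OF d(1), of k] d(2) by simp
      have "ennreal ((weight d / weight (vec_step k d)) ^ 3) * ennreal (1 / weight d ^ 3) =
          ennreal (1 / weight (vec_step k d) ^ 3)"
        using d d' by (simp add: ennreal_mult[symmetric] power_divide)
      moreover have "fst (S_map k (S_word w u)) = weight d / weight (vec_step k d)"
        using d by (simp add: S_word_project[OF u] S_map_project(2) d_def[symmetric])
      ultimately show ?thesis
        using u by (simp add: G_def d_def[symmetric] mult.assoc)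
    qed simp
  qed
  finally show ?case .
qed

text \<open>
  The points with an infinite expansion, expressed through the Borel map \<open>triangle_step\<close> so that they
  visibly form a Borel set.
\<close>

definition expanding :: "(real \<times> real) set" where
  "expanding = {z. \<forall>i. (triangle_step ^^ i) z \<in> (\<Union>k. subtriangle k)}"

lemma expanding_borel [measurable]: "expanding \<in> sets borel"
proof -
  have [measurable]: "(triangle_step ^^ i) \<in> borel_measurable borel" for i
    using triangle.funpow_measurable[of i] by simp
  have [measurable]: "(\<Union>k. subtriangle k) \<in> sets borel" by measurable
  show ?thesis unfolding expanding_def by measurable
qed

lemma expanding_step: "z \<in> expanding \<Longrightarrow> triangle_step z \<in> expanding"
  unfolding expanding_def mem_Collect_eq
proof
  fix i
  assume "\<forall>i. (triangle_step ^^ i) z \<in> (\<Union>k. subtriangle k)"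
  then have "(triangle_step ^^ Suc i) z \<in> (\<Union>k. subtriangle k)" by blast
  then show "(triangle_step ^^ i) (triangle_step z) \<in> (\<Union>k. subtriangle k)"
    by (simp add: funpow_swap1)
qed

lemma expanding_funpow: "z \<in> expanding \<Longrightarrow> (triangle_step ^^ n) z \<in> expanding"
  by (induction n) (auto intro: expanding_step)

lemma expanding_in_subtriangle: "z \<in> expanding \<Longrightarrow> z \<in> subtriangle (triangle_digit z)"
proof -
  assume "z \<in> expanding"
  then have "(triangle_step ^^ 0) z \<in> (\<Union>k. subtriangle k)"
    unfolding expanding_def by blast
  then obtain k where "z \<in> subtriangle k" by auto
  then show ?thesis using triangle_digit_eq[of z k] by simp
qed

lemma expanding_subset: "expanding \<subseteq> open_triangle"
  using expanding_in_subtriangle subtriangle_subset by blast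

lemma AE_expanding: "AE z in invariant_measure. z \<in> expanding"
proof -
  have "AE z in invariant_measure. z \<in> (\<Union>k. subtriangle k)"
    unfolding AE_invariant_measure_iff by (rule AE_subtriangles)
  from triangle.AE_orbit[OF this] show ?thesis
    by (simp add: expanding_def)
qed

primrec digits :: "real \<times> real \<Rightarrow> nat \<Rightarrow> nat list" where
  "digits z 0 = []"
| "digits z (Suc n) = triangle_digit z # digits (triangle_step z) n"

lemma length_digits [simp]: "length (digits z n) = n"
  by (induction n arbitrary: z) auto

lemma digits_nth: "i < n \<Longrightarrow> digits z n ! i = triangle_digit ((triangle_step ^^ i) z)"
proof (induction n arbitrary: z i)
  case (Suc n)
  then show ?case by (cases i) (auto simp: funpow_swap1)
qed simp

lemma digits_add: "digits z (m + n) = digits z m @ digits ((triangle_step ^^ m) z) n"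
  by (induction m arbitrary: z) (auto simp: funpow_swap1)

lemma cylinder_digits:
  assumes "z \<in> cylinder w"
  shows "w = digits z (length w)"
  using assms by (induction w arbitrary: z) (auto simp: cylinder_Cons triangle_digit_eq)

lemma in_cylinder_digits_append:
  assumes "z \<in> expanding" "(triangle_step ^^ n) z \<in> cylinder w"
  shows "z \<in> cylinder (digits z n @ w)"
  using assms
proof (induction n arbitrary: z)
  case (Suc n)
  then have "triangle_step z \<in> cylinder (digits (triangle_step z) n @ w)"
    by (intro Suc.IH) (auto simp: expanding_step funpow_swap1)
  then show ?case using expanding_in_subtriangle[OF Suc.prems(1)] by (simp add: cylinder_Cons)
qed simp

lemma in_cylinder_digits: "z \<in> expanding \<Longrightarrow> z \<in> cylinder (digits z n)"
  using in_cylinder_digits_append[of z n "[]"] expanding_funpow[of z n] expanding_subset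
  by (simp add: subset_iff del: split_paired_All)

section \<open>Positive words: bounded distortion and contraction\<close>

text \<open>
  All entries of the matrix of \<open>vec_word g\<close> are at least \<open>1\<close>: the image of a nonnegative \<open>d\<close> dominates
  \<open>weight d\<close> in each coordinate.
\<close>

definition positive_word :: "nat list \<Rightarrow> bool" where
  "positive_word g \<longleftrightarrow> (\<forall>d. nonneg d \<longrightarrow> nonneg (vec_word g d - weight d *\<^sub>R ones))"

text \<open>
  The sum of all entries of the matrix of \<open>vec_word g\<close>, used as an upper bound for each of them.
\<close>

definition word_bound :: "nat list \<Rightarrow> real" where
  "word_bound g = weight (vec_word g ones)"

lemma word_bound_ge: "3 \<le> word_bound g"
  using weight_vec_word[OF nonneg_ones, of g] by (simp add: word_bound_def weight_ones)

lemma vec_word_le_bound: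
  assumes "nonneg d"
  shows "nonneg ((word_bound g * weight d) *\<^sub>R ones - vec_word g d)"
proof -
  have "nonneg (weight d *\<^sub>R ones - d)"
    using assms by (auto simp: nonneg_def weight_def ones_def split: prod.splits)
  then have "nonneg (vec_word g (weight d *\<^sub>R ones - d))" by (rule nonneg_vec_word)
  then have 1: "nonneg (weight d *\<^sub>R vec_word g ones - vec_word g d)"
    by (simp add: linear_diff[OF linear_vec_word] linear_cmul[OF linear_vec_word])
  have "nonneg (word_bound g *\<^sub>R ones - vec_word g ones)"
    unfolding word_bound_def using nonneg_vec_word[OF nonneg_ones, of g]
    by (auto simp: nonneg_def weight_def ones_def split: prod.splits)
  then have "nonneg (weight d *\<^sub>R (word_bound g *\<^sub>R ones - vec_word g ones))"
    using weight_nonneg[OF assms] by (rule nonneg_scale)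
  from nonneg_add[OF this 1] show ?thesis
    by (simp add: scaleR_right_diff_distrib mult.commute)
qed

text \<open>
  After a positive word the vector is comparable to a multiple of \<open>ones\<close>, and this comparison survives
  every further application of a monotone linear map. So the denominators of \<open>w @ g\<close> vary over the
  triangle by a factor of at most \<open>word_bound g\<close>, whatever \<open>w\<close> is.
\<close>

lemma weight_vec_word_positive_bounds:
  assumes "positive_word g" "nonneg d"
  shows "weight d * weight (vec_word w ones) \<le> weight (vec_word w (vec_word g d))"
    "weight (vec_word w (vec_word g d)) \<le> word_bound g * weight d * weight (vec_word w ones)"
proof -
  have "0 \<le> weight (vec_word w (vec_word g d - weight d *\<^sub>R ones))"
    using assms unfolding positive_word_def by (intro weight_nonneg nonneg_vec_word) blast
  then show "weight d * weight (vec_word w ones) \<le> weight (vec_word w (vec_word g d))"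
    by (simp add: linear_diff[OF linear_vec_word] linear_cmul[OF linear_vec_word]
        linear_diff[OF linear_weight] linear_cmul[OF linear_weight])
  have "0 \<le> weight (vec_word w ((word_bound g * weight d) *\<^sub>R ones - vec_word g d))"
    using vec_word_le_bound[OF assms(2)] by (intro weight_nonneg nonneg_vec_word)
  then show "weight (vec_word w (vec_word g d)) \<le> word_bound g * weight d * weight (vec_word w ones)"
    by (simp add: linear_diff[OF linear_vec_word] linear_cmul[OF linear_vec_word]
        linear_diff[OF linear_weight] linear_cmul[OF linear_weight])
qed

text \<open>
  A bound for the diameter of the closed cylinder of \<open>w\<close>, phrased for the whole nonnegative orthant so
  that it is inherited by words that extend \<open>w\<close>.
\<close>

definition spread_le :: "nat list \<Rightarrow> real \<Rightarrow> bool" where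
  "spread_le w R \<longleftrightarrow> (\<forall>d e. nonneg d \<and> 0 < weight d \<and> nonneg e \<and> 0 < weight e \<longrightarrow>
    dist (project (vec_word w d)) (project (vec_word w e)) \<le> R)"

lemma spread_le_Nil: "spread_le [] 2"
  unfolding spread_le_def
proof (intro allI impI)
  fix d e assume de: "nonneg d \<and> 0 < weight d \<and> nonneg e \<and> 0 < weight e"
  have bd: "0 \<le> fst (project d) \<and> fst (project d) \<le> 1 \<and> 0 \<le> snd (project d) \<and> snd (project d) \<le> 1"
    if "nonneg d" "0 < weight d" for d
    using that by (auto simp: project_def numerators_def nonneg_def weight_def)
  have "dist (project d) (project e) \<le> dist (fst (project d)) (fst (project e)) + dist (snd (project d)) (snd (project e))"
    unfolding dist_prod_def by (rule sqrt_sum_squares_le_sum) auto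
  also have "\<dots> \<le> 1 + 1"
    using bd[of d] bd[of e] de by (intro add_mono) (auto simp: dist_real_def abs_le_iff)
  finally show "dist (project (vec_word [] d)) (project (vec_word [] e)) \<le> 2" by simp
qed

lemma spread_le_append:
  assumes "spread_le v R"
  shows "spread_le (v @ w) R"
  using assms weight_vec_word nonneg_vec_word unfolding spread_le_def vec_word_append
  by (meson order_less_le_trans)

text \<open>
  A Doeblin argument. Every vector produced by the positive word \<open>g\<close> contains a multiple of \<open>ones\<close>, and
  in the image under \<open>vec_word w\<close> this multiple can be chosen to carry exactly the proportion
  \<open>1 / word_bound g\<close> of the weight. Any two points of the cylinder of \<open>w @ g\<close> thus share a common part of
  that proportion, and only the rest contributes to their distance.
\<close>

lemma spread_le_positive:
  assumes "spread_le w R" "positive_word g"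
  shows "spread_le (w @ g) ((1 - 1 / word_bound g) * R)"
proof -
  define L where "L = word_bound g"
  have L: "3 \<le> L" unfolding L_def by (rule word_bound_ge)
  let ?f = "vec_word w"
  define t where "t = weight (?f ones)"
  have t: "0 < t"
    using weight_vec_word[OF nonneg_ones, of w] by (simp add: t_def weight_ones)
  have split: "\<exists>e. nonneg e \<and> 0 < weight e \<and>
      project (?f (vec_word g d)) = (1 / L) *\<^sub>R project (?f ones) + (1 - 1 / L) *\<^sub>R project (?f e)"
    if d: "nonneg d" "0 < weight d" for d
  proof -
    define v where "v = vec_word g d"
    define s where "s = weight (?f v)"
    have s: "weight d * t \<le> s" "s \<le> L * weight d * t"
      using weight_vec_word_positive_bounds[OF assms(2) d(1), of w] by (auto simp: v_def s_def t_def L_def)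
    then have s0: "0 < s" using t d by (smt (verit) mult_pos_pos)
    \<comment> \<open>The multiple of \<open>ones\<close> whose image has weight \<open>s / L\<close>; it is small enough to be subtracted from \<open>v\<close>.\<close>
    define r where "r = s / (L * t)"
    have "r \<le> weight d" using s(2) t L by (simp add: r_def field_simps)
    define e where "e = v - r *\<^sub>R ones"
    have "e = (v - weight d *\<^sub>R ones) + (weight d - r) *\<^sub>R ones"
      by (simp add: e_def algebra_simps)
    moreover have "nonneg (v - weight d *\<^sub>R ones)"
      using assms(2) d unfolding positive_word_def v_def by blast
    ultimately have e: "nonneg e"
      using \<open>r \<le> weight d\<close> by (auto intro!: nonneg_add nonneg_scale nonneg_ones)
    have fv: "?f v = r *\<^sub>R ?f ones + ?f e"
      by (simp add: e_def linear_diff[OF linear_vec_word] linear_cmul[OF linear_vec_word])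
    have "s = r * t + weight (?f e)"
      unfolding s_def fv by (simp add: linear_add[OF linear_weight] linear_cmul[OF linear_weight] t_def)
    moreover have "r * t = s / L" using t by (simp add: r_def)
    ultimately have te: "weight (?f e) = (1 - 1 / L) * s" by (simp add: algebra_simps)
    then have te0: "0 < weight (?f e)" using s0 L by simp
    have "weight e \<noteq> 0"
    proof
      assume "weight e = 0"
      then have "e = 0" using e by (auto simp: weight_def nonneg_def prod_eq_iff)
      then show False using te0 by (simp add: linear_0[OF linear_vec_word] linear_0[OF linear_weight])
    qed
    then have "0 < weight e" using weight_nonneg[OF e] by simp
    moreover have "project (?f v) = (1 / L) *\<^sub>R project (?f ones) + (1 - 1 / L) *\<^sub>R project (?f e)"
    proof -
      have "project (?f v) = (1 / s) *\<^sub>R (r *\<^sub>R numerators (?f ones) + numerators (?f e))"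
        unfolding project_def s_def[symmetric] unfolding fv
        by (simp add: linear_add[OF linear_numerators] linear_cmul[OF linear_numerators])
      also have "\<dots> = (1 / L * (1 / t)) *\<^sub>R numerators (?f ones) + (1 / s) *\<^sub>R numerators (?f e)"
        using s0 by (simp add: scaleR_right_distrib r_def)
      also have "1 / s = (1 - 1 / L) * (1 / weight (?f e))"
        using L s0 by (simp add: te)
      finally show ?thesis by (simp add: project_def t_def)
    qed
    ultimately show ?thesis using e unfolding v_def by blast
  qed
  show ?thesis
    unfolding spread_le_def
  proof (intro allI impI)
    fix d d' assume dd': "nonneg d \<and> 0 < weight d \<and> nonneg d' \<and> 0 < weight d'"
    obtain e e' where e: "nonneg e" "0 < weight e" "nonneg e'" "0 < weight e'"
      and p: "project (?f (vec_word g d)) = (1 / L) *\<^sub>R project (?f ones) + (1 - 1 / L) *\<^sub>R project (?f e)"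
      and p': "project (?f (vec_word g d')) = (1 / L) *\<^sub>R project (?f ones) + (1 - 1 / L) *\<^sub>R project (?f e')"
      using split[of d] split[of d'] dd' by blast
    have "dist (project (?f (vec_word g d))) (project (?f (vec_word g d'))) =
        norm ((1 - 1 / L) *\<^sub>R (project (?f e) - project (?f e')))"
      unfolding p p' dist_norm by (simp add: scaleR_right_diff_distrib)
    also have "\<dots> = (1 - 1 / L) * dist (project (?f e)) (project (?f e'))"
      using L by (simp add: dist_norm)
    also have "\<dots> \<le> (1 - 1 / L) * R"
    proof (rule mult_left_mono)
      show "dist (project (?f e)) (project (?f e')) \<le> R"
        using assms(1) e unfolding spread_le_def by blast
    qed (use L in simp)
    finally show "dist (project (vec_word (w @ g) d)) (project (vec_word (w @ g) d')) \<le>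
        (1 - 1 / word_bound g) * R"
      by (simp add: vec_word_append L_def)
  qed
qed

lemma cylinder_subset_cball:
  assumes "spread_le w R" "z \<in> cylinder w"
  shows "cylinder w \<subseteq> cball z R"
proof
  fix z' assume "z' \<in> cylinder w"
  then obtain u u' where u: "u \<in> open_triangle" "u' \<in> open_triangle" "z = S_word w u" "z' = S_word w u'"
    using assms(2) by (auto simp: cylinder_def)
  then have "dist z z' \<le> R"
    using assms(1) nonneg_homogenize[of u] nonneg_homogenize[of u']
    by (simp add: spread_le_def S_word_project weight_homogenize del: split_paired_All)
  then show "z' \<in> cball z R" by simp
qed

text \<open>
  Each visit to the cylinder of \<open>g\<close> that begins after the previous one has ended multiplies the diameter
  bound by the factor \<open>1 - 1 / word_bound g\<close>.
\<close>

lemma cylinders_shrink: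
  assumes z: "z \<in> expanding" and g: "positive_word g"
    and rec: "\<And>n. \<exists>j\<ge>n. (triangle_step ^^ j) z \<in> cylinder g" and "0 < \<epsilon>"
  shows "\<exists>n. z \<in> cylinder (digits z n @ g) \<and> cylinder (digits z n @ g) \<subseteq> cball z \<epsilon>"
proof -
  define q where "q = 1 - 1 / word_bound g"
  have q: "0 \<le> q" "q < 1" using word_bound_ge[of g] by (auto simp: q_def)
  have step: "\<exists>j. (triangle_step ^^ j) z \<in> cylinder g \<and> spread_le (digits z j @ g) (q ^ Suc i * 2)" for i
  proof (induction i)
    case 0
    obtain j where "(triangle_step ^^ j) z \<in> cylinder g" using rec by blast
    moreover have "spread_le (digits z j @ g) (q * 2)"
      unfolding q_def using spread_le_append[OF spread_le_Nil, of "digits z j"] g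
      by (intro spread_le_positive) auto
    ultimately show ?case by auto
  next
    case (Suc i)
    then obtain j where j: "(triangle_step ^^ j) z \<in> cylinder g" "spread_le (digits z j @ g) (q ^ Suc i * 2)"
      by blast
    obtain j' where j': "j + length g \<le> j'" "(triangle_step ^^ j') z \<in> cylinder g"
      using rec by blast
    obtain m where m: "j' = j + (length g + m)" using j'(1) by (metis add.assoc le_Suc_ex)
    \<comment> \<open>The visit at time \<open>j\<close> spells out \<open>g\<close>, so the digits up to time \<open>j'\<close> begin with \<open>digits z j @ g\<close>.\<close>
    have "digits ((triangle_step ^^ j) z) (length g) = g"
      using cylinder_digits[OF j(1)] by simp
    then have "digits z j' = (digits z j @ g) @ digits ((triangle_step ^^ length g) ((triangle_step ^^ j) z)) m"
      unfolding m digits_add by simp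
    then have "spread_le (digits z j') (q ^ Suc i * 2)"
      using spread_le_append[OF j(2)] by simp
    then have "spread_le (digits z j' @ g) (q * (q ^ Suc i * 2))"
      unfolding q_def using g by (intro spread_le_positive)
    then show ?case using j'(2) by (auto simp: mult.assoc)
  qed
  have "(\<lambda>i. q ^ Suc i * 2) \<longlonglongrightarrow> 0 * 2"
    using q by (intro tendsto_mult tendsto_const LIMSEQ_Suc[OF LIMSEQ_realpow_zero])
  then have "eventually (\<lambda>i. q ^ Suc i * 2 < \<epsilon>) sequentially"
    using \<open>0 < \<epsilon>\<close> by (simp add: order_tendsto_iff)
  then obtain i where "q ^ Suc i * 2 < \<epsilon>" by (auto simp: eventually_sequentially)
  moreover obtain j where j: "(triangle_step ^^ j) z \<in> cylinder g" "spread_le (digits z j @ g) (q ^ Suc i * 2)"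
    using step by blast
  moreover have "z \<in> cylinder (digits z j @ g)"
    using z j(1) by (rule in_cylinder_digits_append)
  ultimately have "cylinder (digits z j @ g) \<subseteq> cball z \<epsilon>"
    using cylinder_subset_cball[OF j(2)] by (meson less_imp_le order_trans subset_cball)
  with \<open>z \<in> cylinder (digits z j @ g)\<close> show ?thesis by blast
qed

section \<open>Every expansion has a positive prefix\<close>

text \<open>
  The next three lemmas follow the positive entries of a product of step matrices row by row. The third
  row is positive after two steps, for all digits. The first row of \<open>k # w\<close> contains \<open>k\<close> times the third
  row of \<open>w\<close> and dominates the second row of \<open>w\<close>, while the second row of \<open>k # w\<close> is the first row of \<open>w\<close>. So
  the first row becomes positive through a nonzero digit at an even position, and the second row through
  one at an odd position.
\<close>

lemma third_row_ge:
  assumes "2 \<le> length w" "nonneg d"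
  shows "weight d \<le> snd (snd (vec_word w d))"
proof -
  obtain k l v where w: "w = k # l # v"
    using assms(1) by (cases w; cases "tl w") auto
  have "snd (snd (vec_word w d)) = weight (vec_word v d)"
    by (simp add: w vec_step_def weight_def split: prod.splits)
  then show ?thesis using weight_vec_word[OF assms(2)] by simp
qed

lemma first_row_ge:
  assumes "even i" "i + 2 < length w" "1 \<le> w ! i" "nonneg d"
  shows "weight d \<le> fst (vec_word w d)"
  using assms(1,2,3)
proof (induction i arbitrary: w rule: less_induct)
  case (less i)
  obtain k v where w: "w = k # v" using less.prems by (cases w) auto
  obtain a b c where v: "vec_word v d = (a, b, c)" by (cases "vec_word v d")
  have abc: "0 \<le> a" "0 \<le> b" "0 \<le> c"
    using nonneg_vec_word[OF assms(4), of v] by (auto simp: v nonneg_def)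
  have fst: "fst (vec_word w d) = b + real k * (b + c)"
    by (simp add: w v vec_step_def)
  show ?case
  proof (cases "i = 0")
    case True
    then have "weight d \<le> c" "1 \<le> real k"
      using third_row_ge[of v d] less.prems assms(4) by (auto simp: w v)
    moreover have "b + c \<le> real k * (b + c)"
      using mult_right_mono[OF \<open>1 \<le> real k\<close>, of "b + c"] abc by simp
    ultimately show ?thesis unfolding fst using abc by (smt (verit))
  next
    case False
    then obtain i' where i: "i = Suc (Suc i')"
      using less.prems by (metis even_Suc not0_implies_Suc even_zero)
    obtain l v' where v': "v = l # v'" using less.prems by (cases v) (auto simp: w)
    have "weight d \<le> fst (vec_word v' d)"
      using less.prems by (intro less.IH[of i']) (auto simp: i w v')
    also have "\<dots> = b"
      using v by (simp add: v' vec_step_def split: prod.splits)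
    also have "\<dots> \<le> b + real k * (b + c)" using abc by simp
    finally show ?thesis unfolding fst .
  qed
qed

lemma positive_wordI:
  assumes "even i" "i + 2 < length w" "1 \<le> w ! i"
    and "odd j" "j + 2 < length w" "1 \<le> w ! j"
  shows "positive_word w"
  unfolding positive_word_def
proof (intro allI impI)
  fix d assume d: "nonneg d"
  obtain k v where w: "w = k # v" using assms(2) by (cases w) auto
  obtain j' where j: "j = Suc j'" using \<open>odd j\<close> by (cases j) auto
  have "weight d \<le> fst (vec_word w d)" using assms(1-3) d by (rule first_row_ge)
  moreover have "weight d \<le> fst (vec_word v d)"
    using assms(4-6) d by (intro first_row_ge[of j']) (auto simp: w j)
  moreover have "fst (vec_word v d) = fst (snd (vec_word w d))"
    by (simp add: w vec_step_def split: prod.splits)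
  moreover have "weight d \<le> snd (snd (vec_word w d))"
    using assms(2) d by (intro third_row_ge) auto
  ultimately show "nonneg (vec_word w d - weight d *\<^sub>R ones)"
    by (simp add: nonneg_def ones_def)
qed

text \<open>
  In homogeneous coordinates a zero digit takes \<open>(a, b, c)\<close> to \<open>(b, a, c - a)\<close>, and the next step moves
  \<open>a\<close> back to the front and does not increase the last coordinate. So the ratio of the last coordinate
  to the first, which is \<open>\<rho>\<close>, drops by at least \<open>1\<close>.
\<close>

lemma zero_digit_ratio_decreases:
  assumes "z \<in> expanding" "triangle_digit z = 0"
  defines "\<rho> \<equiv> \<lambda>z. snd z / (1 - fst z)"
  shows "\<rho> (triangle_step (triangle_step z)) < \<rho> z - 1"
proof -
  obtain x y where z: "z = (x, y)" by (cases z)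
  have "z \<in> subtriangle 0" using expanding_in_subtriangle[OF assms(1)] assms(2) by simp
  then have xy: "0 < y" "y < x" "x < 1" "1 < x + y"
    using subtriangle_subset[of 0] by (auto simp: z mem_subtriangle_iff open_triangle_def)
  define z2 where "z2 = triangle_step (triangle_step z)"
  have "z2 \<in> open_triangle"
    unfolding z2_def using assms(1) expanding_step expanding_subset by blast
  then have z2: "0 < snd z2" "snd z2 < fst z2" "fst z2 < 1" by (auto simp: open_triangle_def)
  have "triangle_step z = (y / x, (x + y - 1) / x)"
    using assms(2) by (simp add: triangle_step_def z)
  then have "fst z2 = (x + y - 1) / y"
    using xy unfolding z2_def triangle_step_def[of "triangle_step z"] by simp
  moreover from this have "1 - fst z2 = (1 - x) / y"
    using xy by (simp add: field_simps)
  ultimately have "fst z2 / (1 - fst z2) = (x + y - 1) / (1 - x)"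
    using xy by (simp only:) simp
  also have "\<dots> = y / (1 - x) - 1"
    using xy by (simp add: field_simps)
  finally have "fst z2 / (1 - fst z2) = y / (1 - x) - 1" .
  moreover have "snd z2 / (1 - fst z2) < fst z2 / (1 - fst z2)"
    using z2 by (simp add: divide_strict_right_mono)
  ultimately show ?thesis by (simp add: \<rho>_def z z2_def)
qed

text \<open>
  Otherwise the positive quantity \<open>\<rho>\<close> would decrease by \<open>1\<close> in every second step, forever.
\<close>

lemma exists_positive_even_digit:
  assumes "z \<in> expanding"
  shows "\<exists>i. even i \<and> 1 \<le> triangle_digit ((triangle_step ^^ i) z)"
proof (rule ccontr)
  assume neg: "\<not> ?thesis"
  define \<rho> where "\<rho> z = snd z / (1 - fst z)" for z :: "real \<times> real"
  have "\<rho> ((triangle_step ^^ (2 * m)) z) \<le> \<rho> z - real m" for m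
  proof (induction m)
    case (Suc m)
    define u where "u = (triangle_step ^^ (2 * m)) z"
    have "triangle_digit u = 0" using neg by (auto simp: u_def not_le)
    moreover have "u \<in> expanding" unfolding u_def using assms by (rule expanding_funpow)
    ultimately have "\<rho> (triangle_step (triangle_step u)) < \<rho> u - 1"
      unfolding \<rho>_def by (rule zero_digit_ratio_decreases[rotated])
    then show ?case using Suc by (simp add: u_def)
  qed simp
  moreover have "0 < \<rho> ((triangle_step ^^ (2 * m)) z)" for m
  proof -
    have "(triangle_step ^^ (2 * m)) z \<in> open_triangle"
      using expanding_funpow[OF assms] expanding_subset by blast
    then show ?thesis by (auto simp: \<rho>_def open_triangle_def)
  qed
  ultimately have "real m < \<rho> z" for m
    by (smt (verit))
  then show False using reals_Archimedean2 by (metis less_asym)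
qed

lemma exists_positive_prefix:
  assumes "z \<in> expanding"
  shows "\<exists>n. positive_word (digits z n)"
proof -
  obtain i where i: "even i" "1 \<le> triangle_digit ((triangle_step ^^ i) z)"
    using exists_positive_even_digit[OF assms] by blast
  obtain j where j: "even j" "1 \<le> triangle_digit ((triangle_step ^^ j) (triangle_step z))"
    using exists_positive_even_digit[OF expanding_step[OF assms]] by blast
  \<comment> \<open>Two further digits have to follow the positions \<open>i\<close> and \<open>Suc j\<close>.\<close>
  have "positive_word (digits z (i + j + 4))"
    using i j by (intro positive_wordI[of i _ "Suc j"]) (auto simp: digits_nth funpow_swap1)
  then show ?thesis by blast
qed

section \<open>Ergodicity\<close>

lemma emeasure_open_triangle_le_1: "emeasure lborel open_triangle \<le> 1"
proof -
  have "open_triangle \<subseteq> cbox (0, 0) (1, 1)"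
    by (auto simp: open_triangle_def)
  then have "emeasure lborel open_triangle \<le> emeasure lborel (cbox (0, 0) (1 :: real, 1 :: real))"
    by (intro emeasure_mono) auto
  also have "\<dots> = 1"
    by (simp add: emeasure_lborel_cbox_eq Basis_prod_def)
  finally show ?thesis .
qed

text \<open>
  On a cylinder ending in a positive word an invariant set occupies at least a fixed multiple of the
  measure that it has in the whole triangle. The branch maps \<open>A \<inter> open_triangle\<close> onto the part of
  \<open>A\<close> in the cylinder, and its Jacobian varies by at most the factor \<open>word_bound g ^ 3\<close>.
\<close>

lemma emeasure_invariant_cylinder_ge:
  assumes [measurable]: "A \<in> sets borel" and A: "triangle_step -` A = A" and g: "positive_word g"
  shows "ennreal (1 / word_bound g ^ 3) * emeasure lborel (A \<inter> open_triangle) * emeasure lborel (cylinder (w @ g))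
    \<le> emeasure lborel (A \<inter> cylinder (w @ g))"
proof -
  define L where "L = word_bound g"
  define t where "t = weight (vec_word w ones)"
  define q where "q u = weight (vec_word (w @ g) (homogenize u))" for u
  have L: "3 \<le> L" unfolding L_def by (rule word_bound_ge)
  have t: "0 < t"
    using weight_vec_word[OF nonneg_ones, of w] by (simp add: t_def weight_ones)
  have q: "t \<le> q u" "q u \<le> L * t" if "u \<in> open_triangle" for u
    using weight_vec_word_positive_bounds[OF g nonneg_homogenize[OF that], of w]
    by (auto simp: q_def t_def L_def vec_word_append weight_homogenize)
  have S_in: "S_word v u \<in> A \<longleftrightarrow> u \<in> A" if "u \<in> open_triangle" for u v
  proof (induction v)
    case (Cons k v)
    have "S_map k (S_word v u) \<in> A \<longleftrightarrow> triangle_step (S_map k (S_word v u)) \<in> A"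
      using A by blast
    then show ?case using Cons triangle_step_S_map[OF S_word_in_triangle[OF that]] by simp
  qed simp
  have "emeasure lborel (cylinder (w @ g)) = (\<integral>\<^sup>+z\<in>cylinder (w @ g). 1 \<partial>lborel)"
    by simp
  also have "\<dots> = (\<integral>\<^sup>+u\<in>open_triangle. (1 * ennreal (1 / q u ^ 3)) \<partial>lborel)"
    unfolding q_def by (rule nn_integral_cylinder) simp
  also have "\<dots> \<le> (\<integral>\<^sup>+u. ennreal (1 / t ^ 3) * indicator open_triangle u \<partial>lborel)"
  proof (intro nn_integral_mono)
    fix u :: "real \<times> real"
    show "1 * ennreal (1 / q u ^ 3) * indicator open_triangle u \<le> ennreal (1 / t ^ 3) * indicator open_triangle u"
      using q(1)[of u] t
      by (auto simp: indicator_def intro!: ennreal_leI divide_left_mono power_mono mult_pos_pos zero_less_power)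
  qed
  also have "\<dots> = ennreal (1 / t ^ 3) * emeasure lborel open_triangle"
    by (simp add: nn_integral_cmult)
  also have "\<dots> \<le> ennreal (1 / t ^ 3) * 1"
    by (intro mult_left_mono emeasure_open_triangle_le_1) simp
  finally have upper: "emeasure lborel (cylinder (w @ g)) \<le> ennreal (1 / t ^ 3)" by simp
  have "ennreal (1 / L ^ 3) * emeasure lborel (A \<inter> open_triangle) * emeasure lborel (cylinder (w @ g))
      \<le> ennreal (1 / L ^ 3) * emeasure lborel (A \<inter> open_triangle) * ennreal (1 / t ^ 3)"
    by (intro mult_left_mono upper) simp
  also have "\<dots> = ennreal (1 / (L * t) ^ 3) * emeasure lborel (A \<inter> open_triangle)"
  proof -
    have "ennreal (1 / L ^ 3) * ennreal (1 / t ^ 3) = ennreal (1 / (L * t) ^ 3)"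
      using L t by (simp add: ennreal_mult[symmetric] power_mult_distrib)
    then show ?thesis by (metis mult.assoc mult.commute)
  qed
  also have "\<dots> = (\<integral>\<^sup>+u. ennreal (1 / (L * t) ^ 3) * indicator (A \<inter> open_triangle) u \<partial>lborel)"
    by (simp add: nn_integral_cmult)
  also have "\<dots> \<le> (\<integral>\<^sup>+u\<in>open_triangle. (indicator A (S_word (w @ g) u) * ennreal (1 / q u ^ 3)) \<partial>lborel)"
  proof (intro nn_integral_mono)
    fix u :: "real \<times> real"
    show "ennreal (1 / (L * t) ^ 3) * indicator (A \<inter> open_triangle) u \<le>
      indicator A (S_word (w @ g) u) * ennreal (1 / q u ^ 3) * indicator open_triangle u"
    proof (cases "u \<in> A \<inter> open_triangle")
      case True
      then have "0 < q u" using q(1)[of u] t by auto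
      then have "1 / (L * t) ^ 3 \<le> 1 / q u ^ 3"
        using q(2)[of u] True L t by (intro divide_left_mono power_mono mult_pos_pos zero_less_power) auto
      then show ?thesis using True S_in[of u "w @ g"] by (simp add: ennreal_leI)
    qed simp
  qed
  also have "\<dots> = (\<integral>\<^sup>+z\<in>cylinder (w @ g). indicator A z \<partial>lborel)"
    unfolding q_def by (rule nn_integral_cylinder[symmetric]) simp
  also have "\<dots> = emeasure lborel (A \<inter> cylinder (w @ g))"
    by (simp flip: indicator_inter_arith)
  finally show ?thesis by (simp add: L_def)
qed

text \<open>
  Knopp's argument. Let \<open>B\<close> consist of the points outside \<open>A\<close> that return to the cylinder of \<open>g\<close>
  infinitely often, and let \<open>U\<close> be an open set that contains \<open>B\<close> and is barely larger. Arbitrarily small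
  cylinders of words \<open>w @ g\<close> surround every point of \<open>B\<close>, so such cylinders inside \<open>U\<close> cover \<open>B\<close>.
  In each of them \<open>A\<close> has at least the proportion \<open>c\<close> of the measure, so \<open>c\<close> times the measure of \<open>B\<close>
  is bounded by the measure of \<open>U - B\<close>, which is arbitrarily small.
\<close>

lemma recurrent_complement_null:
  assumes [measurable]: "A \<in> sets borel" and A: "triangle_step -` A = A" and g: "positive_word g"
    and pos: "emeasure lborel (A \<inter> open_triangle) \<noteq> 0"
  shows "emeasure lborel {z \<in> expanding - A. \<forall>n. \<exists>j\<ge>n. (triangle_step ^^ j) z \<in> cylinder g} = 0"
    (is "emeasure lborel ?B = 0")
proof -
  have [measurable]: "(triangle_step ^^ i) \<in> borel_measurable borel" for i
    using triangle.funpow_measurable[of i] by simp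
  have B [measurable]: "?B \<in> sets borel" by measurable
  define c where "c = ennreal (1 / word_bound g ^ 3) * emeasure lborel (A \<inter> open_triangle)"
  have "1 / word_bound g ^ 3 > 0" using word_bound_ge[of g] by simp
  then have c: "c \<noteq> 0" using pos by (simp add: c_def)
  have "c * emeasure lborel ?B \<le> ennreal e" if "0 < e" for e
  proof -
    obtain U where U: "open U" "?B \<subseteq> U" "emeasure lborel (U - ?B) < ennreal e"
      using outer_regular_lborel[of ?B e] B \<open>0 < e\<close> by auto
    have [measurable]: "U \<in> sets borel" using U(1) by simp
    define \<C> where "\<C> = {w @ g | w. cylinder (w @ g) \<subseteq> U}"
    \<comment> \<open>Cylinders are nested or disjoint, so the minimal words in \<open>\<C>\<close> give disjoint cylinders with the same union.\<close>
    define \<M> where "\<M> = {v \<in> \<C>. \<forall>m < length v. take m v \<notin> \<C>}"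
    define V where "V = (\<Union>v\<in>\<M>. cylinder v)"
    have [measurable]: "V \<in> sets borel"
      unfolding V_def by (intro sets.countable_UN') auto
    have "?B \<subseteq> V"
    proof
      fix z assume z: "z \<in> ?B"
      then obtain r where r: "0 < r" "ball z r \<subseteq> U"
        using U(1,2) by (meson openE subsetD)
      obtain n where n: "z \<in> cylinder (digits z n @ g)" "cylinder (digits z n @ g) \<subseteq> cball z (r / 2)"
        using cylinders_shrink[of z g "r / 2"] z g r(1) by auto
      \<comment> \<open>The radius is halved because the cylinders shrink into closed balls.\<close>
      have "cball z (r / 2) \<subseteq> ball z r" using r(1) by auto
      then have C: "digits z n @ g \<in> \<C>" using n(2) r(2) by (auto simp: \<C>_def)
      define v where "v = digits z n @ g"
      have ex: "\<exists>m. take m v \<in> \<C>"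
        using C by (intro exI[of _ "length v"]) (simp add: v_def)
      define m where "m = (LEAST m. take m v \<in> \<C>)"
      have m: "take m v \<in> \<C>" unfolding m_def using ex by (rule LeastI_ex)
      have "take i (take m v) \<notin> \<C>" if "i < length (take m v)" for i
      proof -
        have "i < m" using that by simp
        then have "take i v \<notin> \<C>" unfolding m_def by (rule not_less_Least)
        then show ?thesis using \<open>i < m\<close> by (simp add: min_def)
      qed
      with m have "take m v \<in> \<M>" by (auto simp: \<M>_def)
      moreover have "z \<in> cylinder (take m v)"
        using cylinder_append_subset[of "take m v" "drop m v"] n(1)
        unfolding append_take_drop_id v_def[symmetric] by blast
      ultimately show "z \<in> V" by (auto simp: V_def)
    qed
    have disj: "disjoint_family_on cylinder \<M>"
      unfolding disjoint_family_on_def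
    proof (intro ballI impI)
      fix v v' assume v: "v \<in> \<M>" "v' \<in> \<M>" "v \<noteq> v'"
      have False if z: "z \<in> cylinder v" "z \<in> cylinder v'" and le: "length v \<le> length v'"
        and v: "v \<in> \<M>" "v' \<in> \<M>" "v \<noteq> v'" for z v v'
      proof -
        obtain d where d: "length v' = length v + d" using le le_Suc_ex by blast
        have "v' = digits z (length v) @ digits ((triangle_step ^^ length v) z) d"
          using cylinder_digits[OF z(2)] by (simp add: d digits_add)
        then have "take (length v) v' = v"
          using cylinder_digits[OF z(1)] by simp
        moreover from this have "length v < length v'" using v(3) le by (cases "length v = length v'") auto
        ultimately show False using v by (auto simp: \<M>_def)
      qed
      then show "cylinder v \<inter> cylinder v' = {}"
        using v by (metis disjoint_iff nat_le_linear)
    qed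
    have "c * emeasure lborel ?B \<le> c * emeasure lborel V"
      using \<open>?B \<subseteq> V\<close> by (intro mult_left_mono emeasure_mono) auto
    also have "emeasure lborel V = (\<integral>\<^sup>+v. emeasure lborel (cylinder v) \<partial>count_space \<M>)"
      unfolding V_def using disj by (intro emeasure_UN_countable) auto
    also have "c * \<dots> = (\<integral>\<^sup>+v. c * emeasure lborel (cylinder v) \<partial>count_space \<M>)"
      by (rule nn_integral_cmult[symmetric]) simp
    also have "\<dots> \<le> (\<integral>\<^sup>+v. emeasure lborel (A \<inter> cylinder v) \<partial>count_space \<M>)"
    proof (intro nn_integral_mono)
      fix v assume "v \<in> space (count_space \<M>)"
      then obtain w where "v = w @ g" by (auto simp: \<M>_def \<C>_def)
      then show "c * emeasure lborel (cylinder v) \<le> emeasure lborel (A \<inter> cylinder v)"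
        unfolding c_def using emeasure_invariant_cylinder_ge[OF _ A g, of w] by simp
    qed
    also have "\<dots> = emeasure lborel (\<Union>v\<in>\<M>. A \<inter> cylinder v)"
      using disj by (intro emeasure_UN_countable[symmetric]) (auto simp: disjoint_family_on_def)
    also have "\<dots> \<le> emeasure lborel (U - ?B)"
      by (intro emeasure_mono) (auto simp: \<M>_def \<C>_def)
    also have "\<dots> \<le> ennreal e" using U(3) by simp
    finally show ?thesis .
  qed
  then have "c * emeasure lborel ?B \<le> 0 + ennreal e" if "0 < e" for e
    using that by simp
  then have "c * emeasure lborel ?B \<le> 0"
    by (rule ennreal_le_epsilon)
  then show ?thesis using c by simp
qed

text \<open>
  Almost every point has an expansion with a positive prefix and, by recurrence, returns infinitely often
  to the cylinder of this prefix. There are only countably many words, so the previous lemma shows that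
  an invariant set of positive measure misses only a null set.
\<close>

interpretation triangle: ergodic_transformation invariant_measure triangle_step
proof (intro ergodic_transformation.intro ergodic_transformation_axioms.intro)
  show "measure_preserving invariant_measure triangle_step" by unfold_locales
  fix A assume "A \<in> sets invariant_measure" and "triangle_step -` A \<inter> space invariant_measure = A"
  then have A [measurable]: "A \<in> sets borel" and inv: "triangle_step -` A = A" by simp_all
  show "emeasure invariant_measure A = 0 \<or> emeasure invariant_measure (space invariant_measure - A) = 0"
  proof (cases "emeasure lborel (A \<inter> open_triangle) = 0")
    case True
    then have "A \<inter> open_triangle \<in> null_sets lborel" by (intro null_setsI) auto
    from AE_not_in[OF this] have "AE z in invariant_measure. z \<notin> A"
      unfolding AE_invariant_measure_iff by eventually_elim auto
    then have "A \<in> null_sets invariant_measure" by (simp add: AE_iff_null_sets)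
    then show ?thesis by auto
  next
    case False
    have 1: "AE z in invariant_measure. \<forall>g. positive_word g \<longrightarrow> z \<in> expanding \<longrightarrow>
        (\<forall>n. \<exists>j\<ge>n. (triangle_step ^^ j) z \<in> cylinder g) \<longrightarrow> z \<in> A"
      unfolding AE_all_countable
    proof
      fix g :: "nat list"
      show "AE z in invariant_measure. positive_word g \<longrightarrow> z \<in> expanding \<longrightarrow>
        (\<forall>n. \<exists>j\<ge>n. (triangle_step ^^ j) z \<in> cylinder g) \<longrightarrow> z \<in> A"
      proof (cases "positive_word g")
        case True
        have [measurable]: "(triangle_step ^^ i) \<in> borel_measurable borel" for i
          using triangle.funpow_measurable[of i] by simp
        have "{z \<in> expanding - A. \<forall>n. \<exists>j\<ge>n. (triangle_step ^^ j) z \<in> cylinder g} \<in> null_sets lborel"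
          using recurrent_complement_null[OF A inv True False] by (intro null_setsI) auto
        from AE_not_in[OF this] show ?thesis
          unfolding AE_invariant_measure_iff by eventually_elim auto
      qed simp
    qed
    have 2: "AE z in invariant_measure. \<forall>g. (\<exists>j. (triangle_step ^^ j) z \<in> cylinder g) \<longrightarrow>
        (\<forall>n. \<exists>j\<ge>n. (triangle_step ^^ j) z \<in> cylinder g)"
      unfolding AE_all_countable by (intro allI triangle.recurrence) simp
    from 1 2 AE_expanding have "AE z in invariant_measure. z \<in> A"
    proof eventually_elim
      case (elim z)
      obtain n where n: "positive_word (digits z n)"
        using exists_positive_prefix elim(3) by blast
      have "(triangle_step ^^ 0) z \<in> cylinder (digits z n)"
        using in_cylinder_digits[OF elim(3)] by simp
      \<comment> \<open>The prefix of \<open>z\<close> itself is visited at time \<open>0\<close>, hence infinitely often.\<close>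
      then show "z \<in> A" using elim n by blast
    qed
    then have "AE z in invariant_measure. z \<notin> space invariant_measure - A" by simp
    then have "space invariant_measure - A \<in> null_sets invariant_measure"
      by (subst AE_iff_null_sets) auto
    then show ?thesis by auto
  qed
qed

section \<open>Digit frequencies as measures of subtriangles\<close>

lemma funpow_T_map:
  assumes "z \<in> expanding"
  shows "(T_map ^^ i) z = (triangle_step ^^ i) z"
proof (induction i)
  case (Suc i)
  have "(triangle_step ^^ i) z \<in> expanding" using assms by (rule expanding_funpow)
  then show ?case
    using Suc triangle_step_eq_T_map[OF expanding_in_subtriangle, of "(triangle_step ^^ i) z"] by simp
qed simp

lemma has_expansion_expanding: "z \<in> expanding \<Longrightarrow> has_expansion z"
  unfolding has_expansion_def by (simp add: funpow_T_map) (auto simp: expanding_def)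

lemma freq_upto_eq_average:
  assumes "z \<in> expanding"
  shows "freq_upto n k z = (\<Sum>i<n. indicator (subtriangle k) ((triangle_step ^^ i) z)) / real n"
proof -
  have mem: "(triangle_step ^^ i) z \<in> subtriangle k \<longleftrightarrow> digit z (Suc i) = k" for i
  proof -
    have u: "(triangle_step ^^ i) z \<in> subtriangle (triangle_digit ((triangle_step ^^ i) z))"
      using assms by (intro expanding_in_subtriangle expanding_funpow)
    then have "digit z (Suc i) = triangle_digit ((triangle_step ^^ i) z)"
      by (simp add: digit_def funpow_T_map[OF assms] first_digit_eq)
    then show ?thesis using u triangle_digit_eq by metis
  qed
  have "{i. 1 \<le> i \<and> i \<le> n \<and> digit z i = k} = Suc ` {i \<in> {..<n}. (triangle_step ^^ i) z \<in> subtriangle k}"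
    (is "?L = ?R")
  proof (intro set_eqI iffI)
    fix i assume "i \<in> ?L"
    then show "i \<in> ?R" using mem by (cases i) auto
  qed (use mem in auto)
  then have "card {i. 1 \<le> i \<and> i \<le> n \<and> digit z i = k} = card {i \<in> {..<n}. (triangle_step ^^ i) z \<in> subtriangle k}"
    by (simp add: card_image)
  also have "real \<dots> = (\<Sum>i<n. indicator (subtriangle k) ((triangle_step ^^ i) z))"
    by (simp add: indicator_def Int_def flip: sum.inter_filter)
  finally show ?thesis by (simp add: freq_upto_def)
qed

lemma AE_lebesgue_on_triangle:
  assumes "AE z in invariant_measure. P z"
  shows "AE z in lebesgue_on open_triangle. P z"
proof -
  have "AE z in lebesgue. z \<in> open_triangle \<longrightarrow> P z"
    using assms unfolding AE_invariant_measure_iff by (rule AE_completion)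
  then show ?thesis
    by (subst AE_restrict_space_iff) simp_all
qed

lemma AE_digit_frequencies:
  "AE z in lebesgue_on open_triangle. \<forall>k. freq_exists k z \<and> freq k z = measure invariant_measure (subtriangle k)"
proof (rule AE_lebesgue_on_triangle)
  have "AE z in invariant_measure. (\<lambda>n. (\<Sum>i<n. indicator (subtriangle k) ((triangle_step ^^ i) z)) / real n)
      \<longlonglongrightarrow> triangle.expectation (indicator (subtriangle k))" for k
    by (rule triangle.birkhoff[where C = 1]) (auto simp: indicator_def)
  then have "AE z in invariant_measure. \<forall>k. (\<lambda>n. (\<Sum>i<n. indicator (subtriangle k) ((triangle_step ^^ i) z)) / real n)
      \<longlonglongrightarrow> measure invariant_measure (subtriangle k)"
    unfolding AE_all_countable by simp
  with AE_expanding show "AE z in invariant_measure. \<forall>k. freq_exists k z \<and> freq k z = measure invariant_measure (subtriangle k)"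
  proof eventually_elim
    case (elim z)
    then have "(\<lambda>n. freq_upto n k z) \<longlonglongrightarrow> measure invariant_measure (subtriangle k)" for k
      by (simp add: freq_upto_eq_average)
    then show ?case
      using elim(1) unfolding freq_exists_def freq_def convergent_def
      by (blast intro: has_expansion_expanding limI)
  qed
qed

text \<open>
  The triangle is not a null set, so two almost sure values of the same frequency coincide.
\<close>

lemma p_freq_eq: "p_freq k = measure invariant_measure (subtriangle k)"
  unfolding p_freq_def
proof (rule the_equality)
  show ae: "AE z in lebesgue_on open_triangle. freq_exists k z \<and> freq k z = measure invariant_measure (subtriangle k)"
    using AE_digit_frequencies by eventually_elim auto
  fix c assume "AE z in lebesgue_on open_triangle. freq_exists k z \<and> freq k z = c"
  with ae have "AE z in lebesgue_on open_triangle. c = measure invariant_measure (subtriangle k)"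
    by eventually_elim auto
  then have 1: "AE z in lebesgue. z \<in> open_triangle \<longrightarrow> c = measure invariant_measure (subtriangle k)"
    by (subst (asm) AE_restrict_space_iff) simp_all
  show "c = measure invariant_measure (subtriangle k)"
  proof (rule ccontr)
    assume "c \<noteq> measure invariant_measure (subtriangle k)"
    with 1 have "AE z in lebesgue. z \<notin> open_triangle" by simp
    then have "negligible open_triangle"
      by (simp add: negligible_iff_null_sets AE_iff_null_sets)
    moreover have "open open_triangle"
    proof -
      have "open {z :: real \<times> real. 0 < snd z \<and> snd z < fst z \<and> fst z < 1}"
        by (intro open_Collect_conj open_Collect_less continuous_intros)
      also have "{z :: real \<times> real. 0 < snd z \<and> snd z < fst z \<and> fst z < 1} = open_triangle"
        by (auto simp: open_triangle_def)
      finally show ?thesis .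
    qed
    moreover have "(2 / 3, 1 / 3) \<in> open_triangle" by (simp add: open_triangle_def)
    ultimately show False using open_not_negligible by blast
  qed
qed

section \<open>The measures of the subtriangles\<close>

lemma nn_integral_reflect:
  fixes F :: "real \<times> real \<Rightarrow> ennreal"
  assumes [measurable]: "F \<in> borel_measurable borel"
  shows "(\<integral>\<^sup>+z. F (1 - snd z, 1 - fst z) \<partial>lborel) = (\<integral>\<^sup>+z. F z \<partial>lborel)"
proof -
  have "(\<integral>\<^sup>+z. F (1 - snd z, 1 - fst z) \<partial>lborel) = (\<integral>\<^sup>+x. \<integral>\<^sup>+y. F (1 - y, 1 - x) \<partial>lborel \<partial>lborel)"
    by (subst nn_integral_lborel_fst_snd) auto
  also have "\<dots> = (\<integral>\<^sup>+x. \<integral>\<^sup>+y. F (y, 1 - x) \<partial>lborel \<partial>lborel)"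
    by (subst (2) nn_integral_real_affine[where c = "-1" and t = 1]) auto
  also have "\<dots> = (\<integral>\<^sup>+x. \<integral>\<^sup>+y. F (y, x) \<partial>lborel \<partial>lborel)"
    using nn_integral_real_affine[where c = "-1" and t = 1 and f = "\<lambda>x. \<integral>\<^sup>+y. F (y, x) \<partial>lborel"] by simp
  also have "\<dots> = (\<integral>\<^sup>+x. \<integral>\<^sup>+y. F (x, y) \<partial>lborel \<partial>lborel)"
    by (rule nn_integral_lborel_swap[symmetric]) simp
  also have "\<dots> = (\<integral>\<^sup>+z. F z \<partial>lborel)"
    by (rule nn_integral_lborel_fst_snd[symmetric]) simp
  finally show ?thesis .
qed

lemma emeasure_invariant_measure:
  assumes [measurable]: "A \<in> sets borel" and "A \<subseteq> open_triangle"
  shows "emeasure invariant_measure A = (\<integral>\<^sup>+z. ennreal (invariant_density z) * indicator A z \<partial>lborel)"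
proof -
  have "emeasure invariant_measure A = (\<integral>\<^sup>+z. indicator A z \<partial>invariant_measure)" by simp
  also have "\<dots> = (\<integral>\<^sup>+z\<in>open_triangle. (indicator A z * ennreal (invariant_density z)) \<partial>lborel)"
    by (rule nn_integral_invariant_measure) simp
  also have "\<dots> = (\<integral>\<^sup>+z. ennreal (invariant_density z) * indicator A z \<partial>lborel)"
    using assms(2) by (intro nn_integral_cong) (auto simp: indicator_def)
  finally show ?thesis .
qed

text \<open>
  The reflection \<open>(x, y) \<mapsto> (1 - y, 1 - x)\<close> preserves the triangle and the invariant density and takes
  \<open>subtriangle 0\<close>, the part above the line \<open>x + y = 1\<close>, to the part below this line.
\<close>

lemma measure_subtriangle_0: "measure invariant_measure (subtriangle 0) = 1 / 2"
proof -
  define C where "C = {z \<in> open_triangle. fst z + snd z < 1}"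
  have [measurable]: "C \<in> sets borel" unfolding C_def by measurable
  have C: "C \<subseteq> open_triangle" by (auto simp: C_def)
  have "emeasure invariant_measure (subtriangle 0) =
      (\<integral>\<^sup>+z. ennreal (invariant_density z) * indicator (subtriangle 0) z \<partial>lborel)"
    by (rule emeasure_invariant_measure) (auto simp: subtriangle_subset)
  also have "\<dots> = (\<integral>\<^sup>+z. ennreal (invariant_density (1 - snd z, 1 - fst z)) *
      indicator (subtriangle 0) (1 - snd z, 1 - fst z) \<partial>lborel)"
    by (rule nn_integral_reflect[symmetric]) simp
  also have "\<dots> = (\<integral>\<^sup>+z. ennreal (invariant_density z) * indicator C z \<partial>lborel)"
  proof (intro nn_integral_cong arg_cong2[where f = "(*)"])
    fix z :: "real \<times> real"
    show "ennreal (invariant_density (1 - snd z, 1 - fst z)) = ennreal (invariant_density z)"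
      by (simp add: invariant_density_def mult_ac)
    show "indicator (subtriangle 0) (1 - snd z, 1 - fst z) = (indicator C z :: ennreal)"
      by (cases z) (auto simp: indicator_def mem_subtriangle_iff C_def open_triangle_def)
  qed
  also have "\<dots> = emeasure invariant_measure C"
    using C by (intro emeasure_invariant_measure[symmetric]) auto
  finally have eq: "emeasure invariant_measure (subtriangle 0) = emeasure invariant_measure C" .
  have "AE z in invariant_measure. z \<in> (\<Union>k. subtriangle k)"
    unfolding AE_invariant_measure_iff by (rule AE_subtriangles)
  then have "AE z in invariant_measure. z \<in> subtriangle 0 \<union> C"
  proof eventually_elim
    case (elim z)
    then obtain k where k: "z \<in> subtriangle k" by auto
    obtain x y where z: "z = (x, y)" by (cases z)
    show ?case
    proof (cases "k = 0")
      case False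
      have "z \<in> open_triangle" using k subtriangle_subset by blast
      moreover have "x + y < 1"
      proof -
        have "0 < y" using \<open>z \<in> open_triangle\<close> by (simp add: z open_triangle_def)
        then have "1 * y \<le> real k * y" using False by (intro mult_right_mono) auto
        then show ?thesis using k by (simp add: z mem_subtriangle_iff)
      qed
      ultimately show ?thesis by (simp add: C_def z)
    qed (use k in simp)
  qed
  then have "measure invariant_measure (subtriangle 0 \<union> C) = 1"
    by (intro triangle.prob_eq_1[THEN iffD2]) auto
  moreover have "subtriangle 0 \<inter> C = {}"
    by (auto simp: C_def mem_subtriangle_iff)
  ultimately have "measure invariant_measure (subtriangle 0) + measure invariant_measure C = 1"
    by (subst (asm) triangle.finite_measure_Union) auto
  then show ?thesis using eq by (simp add: measure_def)
qed

lemma borel_measurable_nn_integral_slice: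
  fixes h :: "real \<Rightarrow> real \<Rightarrow> real" and l u :: "real \<Rightarrow> real"
  assumes h: "(\<lambda>z. h (fst z) (snd z)) \<in> borel_measurable borel"
    and [measurable]: "l \<in> borel_measurable borel" "u \<in> borel_measurable borel"
  shows "(\<lambda>x. \<integral>\<^sup>+y. ennreal (h x y) * indicator {l x..u x} y \<partial>lborel) \<in> borel_measurable borel"
proof -
  let ?F = "\<lambda>z. ennreal (h (fst z) (snd z)) * indicator {z. l (fst z) \<le> snd z \<and> snd z \<le> u (fst z)} z"
  have "?F \<in> borel_measurable borel"
    using h by measurable
  then have "?F \<in> borel_measurable (lborel \<Otimes>\<^sub>M lborel)"
    by (simp add: lborel_prod)
  from lborel.borel_measurable_nn_integral_fst[OF this]
  have "(\<lambda>x. \<integral>\<^sup>+y. ?F (x, y) \<partial>lborel) \<in> borel_measurable borel" by simp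
  also have "(\<lambda>x. \<integral>\<^sup>+y. ?F (x, y) \<partial>lborel) =
      (\<lambda>x. \<integral>\<^sup>+y. ennreal (h x y) * indicator {l x..u x} y \<partial>lborel)"
    by (intro ext nn_integral_cong) (auto simp: indicator_def)
  finally show ?thesis .
qed

text \<open>
  Translation from iterated Lebesgue integrals with values in the extended nonnegative reals to iterated
  Henstock--Kurzweil integrals.
\<close>

lemma nn_integral_iterated_Icc:
  fixes h :: "real \<Rightarrow> real \<Rightarrow> real" and l u :: "real \<Rightarrow> real" and a b :: real
  defines "N \<equiv> \<integral>\<^sup>+x. (\<integral>\<^sup>+y. ennreal (h x y) * indicator {l x..u x} y \<partial>lborel) * indicator {a..b} x \<partial>lborel"
  assumes h: "(\<lambda>z. h (fst z) (snd z)) \<in> borel_measurable borel"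
    and [measurable]: "l \<in> borel_measurable borel" "u \<in> borel_measurable borel"
    and cont: "\<And>x. x \<in> {a..b} \<Longrightarrow> continuous_on {l x..u x} (h x)"
    and nonneg: "\<And>x y. x \<in> {a..b} \<Longrightarrow> y \<in> {l x..u x} \<Longrightarrow> 0 \<le> h x y"
    and fin: "N \<noteq> \<infinity>"
  shows "N = ennreal (integral {a..b} (\<lambda>x. integral {l x..u x} (h x)))"
    "0 \<le> integral {a..b} (\<lambda>x. integral {l x..u x} (h x))"
proof -
  define J where "J x = (\<integral>\<^sup>+y. ennreal (h x y) * indicator {l x..u x} y \<partial>lborel)" for x
  define G where "G x = integral {l x..u x} (h x)" for x
  have J: "J x = ennreal (G x)" "0 \<le> G x" if "x \<in> {a..b}" for x
  proof -
    have "h x integrable_on {l x..u x}"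
      using cont[OF that] by (rule integrable_continuous_real)
    then have "(h x has_integral G x) {l x..u x}"
      unfolding G_def by (rule integrable_integral)
    then show "J x = ennreal (G x)"
      unfolding J_def using nonneg[OF that] by (intro nn_integral_has_integral_lebesgue')
    show "0 \<le> G x" unfolding G_def
      using \<open>h x integrable_on {l x..u x}\<close> nonneg[OF that] by (intro integral_nonneg)
  qed
  have [measurable]: "J \<in> borel_measurable borel"
    unfolding J_def[abs_def] by (rule borel_measurable_nn_integral_slice[OF h]) simp_all
  define f where "f x = enn2real (J x) * indicator {a..b} x" for x
  have f: "f x = (if x \<in> {a..b} then G x else 0)" for x
    using J[of x] by (auto simp: f_def)
  have Nf: "N = (\<integral>\<^sup>+x. ennreal (f x) \<partial>lborel)"
    unfolding N_def J_def[symmetric] using J by (intro nn_integral_cong) (auto simp: f indicator_def)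
  obtain r where r: "0 \<le> r" "N = ennreal r" using fin by (cases N) auto
  have "(f has_integral r) UNIV"
  proof (rule nn_integral_has_integral)
    show "f \<in> borel_measurable borel" unfolding f_def by measurable
    show "0 \<le> f x" for x using J(2) by (simp add: f)
  qed (use r Nf in auto)
  then have "(G has_integral r) {a..b}"
    unfolding f has_integral_restrict_UNIV .
  then have "integral {a..b} G = r" by (rule integral_unique)
  then show "N = ennreal (integral {a..b} (\<lambda>x. integral {l x..u x} (h x)))"
    "0 \<le> integral {a..b} (\<lambda>x. integral {l x..u x} (h x))"
    using r by (simp_all add: G_def[abs_def])
qed

text \<open>
  The vertical slice of the subtriangle at \<open>x\<close> is the open interval from \<open>(1 - x) / (k + 1)\<close> to the
  minimum of \<open>x\<close> and \<open>(1 - x) / k\<close>. It is empty for \<open>x \<le> 1 / (k + 2)\<close>, and the minimum changes from the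
  first to the second at \<open>x = 1 / (k + 1)\<close>.
\<close>

lemma measure_subtriangle_pos:
  assumes "0 < k"
  shows "measure invariant_measure (subtriangle k) =
    integral {1 / (real k + 2) .. 1 / (real k + 1)} (\<lambda>x.
      integral {(1 - x) / (real k + 1) .. x} (\<lambda>y. 6 / (pi\<^sup>2 * x * (1 - y))))
    + integral {1 / (real k + 1) .. 1} (\<lambda>x.
      integral {(1 - x) / (real k + 1) .. (1 - x) / real k} (\<lambda>y. 6 / (pi\<^sup>2 * x * (1 - y))))"
proof -
  define h :: "real \<Rightarrow> real \<Rightarrow> real" where "h x y = 6 / (pi\<^sup>2 * x * (1 - y))" for x y
  define a b where "a = 1 / (real k + 2)" and "b = 1 / (real k + 1)"
  define l u where "l x = (1 - x) / (real k + 1)" and "u x = (1 - x) / real k" for x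
  define N1 where "N1 = (\<integral>\<^sup>+x. (\<integral>\<^sup>+y. ennreal (h x y) * indicator {l x..x} y \<partial>lborel) * indicator {a..b} x \<partial>lborel)"
  define N2 where "N2 = (\<integral>\<^sup>+x. (\<integral>\<^sup>+y. ennreal (h x y) * indicator {l x..u x} y \<partial>lborel) * indicator {b..1} x \<partial>lborel)"
  have k: "1 \<le> real k" using assms by simp
  have ab: "0 < a" "a < b" "b < 1"
    using k by (auto simp: a_def b_def field_simps)
  have [measurable]: "l \<in> borel_measurable borel" "u \<in> borel_measurable borel"
    unfolding l_def u_def by measurable
  have h [measurable]: "(\<lambda>z. h (fst z) (snd z)) \<in> borel_measurable borel"
    unfolding h_def by measurable
  have y1: "0 < x \<and> y < 1" if "x \<in> {a..b}" "y \<in> {l x..x}" for x y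
    using that ab by auto
  have y2: "0 < x \<and> y < 1" if x: "x \<in> {b..1}" and y: "y \<in> {l x..u x}" for x y
  proof -
    have "u x < 1" using x ab k by (simp add: u_def field_simps)
    then show ?thesis using x y ab by auto
  qed
  have cont1: "continuous_on {l x..x} (h x)" if "x \<in> {a..b}" for x
    unfolding h_def using y1[OF that] by (intro continuous_intros) force
  have cont2: "continuous_on {l x..u x} (h x)" if "x \<in> {b..1}" for x
    unfolding h_def using y2[OF that] by (intro continuous_intros) force
  have nn: "0 \<le> h x y" if "0 < x \<and> y < 1" for x y
    using that by (simp add: h_def)
  \<comment> \<open>The point \<open>b\<close> lies in both ranges of \<open>x\<close>; away from the excluded points a slice differs from its interval by endpoints only.\<close>
  have slice: "(\<integral>\<^sup>+y. ennreal (h x y) * indicator (subtriangle k) (x, y) \<partial>lborel) =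
      (\<integral>\<^sup>+y. ennreal (h x y) * indicator {l x..x} y \<partial>lborel) * indicator {a..b} x +
      (\<integral>\<^sup>+y. ennreal (h x y) * indicator {l x..u x} y \<partial>lborel) * indicator {b..1} x"
    if x: "x \<noteq> a" "x \<noteq> b" "x \<noteq> 1" for x
  proof -
    have mem: "(x, y) \<in> subtriangle k \<longleftrightarrow> 0 < x \<and> l x < y \<and> y < x \<and> y < u x" for y
      using k by (auto simp: mem_subtriangle_iff l_def u_def field_simps)
    have lx: "l x < x \<longleftrightarrow> a < x"
      using k by (simp add: l_def a_def field_simps)
    have ux: "x < u x \<longleftrightarrow> x < b" "u x < x \<longleftrightarrow> b < x"
      using k by (simp_all add: u_def b_def field_simps)
    have lu: "l x < u x \<longleftrightarrow> x < 1"
      using k by (simp add: l_def u_def field_simps)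
    consider "x < a" | "a < x" "x < b" | "b < x" "x < 1" | "1 < x"
      using x ab by linarith
    then show ?thesis
    proof cases
      case 1
      then have "(x, y) \<notin> subtriangle k" for y using mem lx by force
      then show ?thesis using 1 ab by simp
    next
      case 2
      have "(\<integral>\<^sup>+y. ennreal (h x y) * indicator (subtriangle k) (x, y) \<partial>lborel) =
          (\<integral>\<^sup>+y. ennreal (h x y) * indicator {l x..x} y \<partial>lborel)"
        using AE_lborel_singleton[of "l x"] AE_lborel_singleton[of x]
        by (intro nn_integral_cong_AE, eventually_elim) (use 2 ux ab in \<open>auto simp: indicator_def mem\<close>)
      then show ?thesis using 2 by simp
    next
      case 3
      have "(\<integral>\<^sup>+y. ennreal (h x y) * indicator (subtriangle k) (x, y) \<partial>lborel) =
          (\<integral>\<^sup>+y. ennreal (h x y) * indicator {l x..u x} y \<partial>lborel)"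
        using AE_lborel_singleton[of "l x"] AE_lborel_singleton[of "u x"]
        by (intro nn_integral_cong_AE, eventually_elim) (use 3 ux ab in \<open>auto simp: indicator_def mem\<close>)
      then show ?thesis using 3 by simp
    next
      case 4
      then have "(x, y) \<notin> subtriangle k" for y using mem lu by force
      then show ?thesis using 4 ab by simp
    qed
  qed
  have [measurable]: "(\<lambda>z. ennreal (h (fst z) (snd z)) * indicator (subtriangle k) z) \<in> borel_measurable borel"
    by measurable
  have [measurable]:
    "(\<lambda>x. \<integral>\<^sup>+y. ennreal (h x y) * indicator {l x..x} y \<partial>lborel) \<in> borel_measurable borel"
    "(\<lambda>x. \<integral>\<^sup>+y. ennreal (h x y) * indicator {l x..u x} y \<partial>lborel) \<in> borel_measurable borel"
    by (rule borel_measurable_nn_integral_slice[OF h]; simp)+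
  have "emeasure invariant_measure (subtriangle k) =
      (\<integral>\<^sup>+z. ennreal (h (fst z) (snd z)) * indicator (subtriangle k) z \<partial>lborel)"
    by (subst emeasure_invariant_measure) (auto simp: subtriangle_subset invariant_density_def h_def)
  also have "\<dots> = (\<integral>\<^sup>+x. \<integral>\<^sup>+y. ennreal (h x y) * indicator (subtriangle k) (x, y) \<partial>lborel \<partial>lborel)"
    by (subst nn_integral_lborel_fst_snd) auto
  also have "\<dots> = (\<integral>\<^sup>+x. (\<integral>\<^sup>+y. ennreal (h x y) * indicator {l x..x} y \<partial>lborel) * indicator {a..b} x +
      (\<integral>\<^sup>+y. ennreal (h x y) * indicator {l x..u x} y \<partial>lborel) * indicator {b..1} x \<partial>lborel)"
    using AE_lborel_singleton[of a] AE_lborel_singleton[of b] AE_lborel_singleton[of 1]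
    by (intro nn_integral_cong_AE, eventually_elim) (rule slice)
  also have "\<dots> = N1 + N2"
    unfolding N1_def N2_def
    by (rule nn_integral_add) simp_all
  finally have sum: "emeasure invariant_measure (subtriangle k) = N1 + N2" .
  then have fin: "N1 \<noteq> \<infinity>" "N2 \<noteq> \<infinity>"
    using triangle.emeasure_finite[of "subtriangle k"] by (auto simp: infinity_ennreal_def)
  have I1: "N1 = ennreal (integral {a..b} (\<lambda>x. integral {l x..x} (h x)))"
      "0 \<le> integral {a..b} (\<lambda>x. integral {l x..x} (h x))"
    using fin(1) unfolding N1_def
    by (intro nn_integral_iterated_Icc[where u = "\<lambda>x. x"]; use h cont1 y1 nn in auto)+
  have I2: "N2 = ennreal (integral {b..1} (\<lambda>x. integral {l x..u x} (h x)))"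
      "0 \<le> integral {b..1} (\<lambda>x. integral {l x..u x} (h x))"
    using fin(2) unfolding N2_def
    by (intro nn_integral_iterated_Icc; use h cont2 y2 nn in auto)+
  have "measure invariant_measure (subtriangle k) =
      integral {a..b} (\<lambda>x. integral {l x..x} (h x)) + integral {b..1} (\<lambda>x. integral {l x..u x} (h x))"
    unfolding measure_def sum using I1 I2 by (simp add: ennreal_plus[symmetric] del: ennreal_plus)
  then show ?thesis
    unfolding h_def[abs_def] l_def u_def a_def b_def .
qed

theorem corollary9:
  shows "(AE z in lebesgue_on open_triangle. \<forall>k. freq_exists k z \<and> freq k z = p_freq k)
    \<and> p_freq 0 = 1 / 2
    \<and> (\<forall>k>0. p_freq k =
          integral {1 / (real k + 2) .. 1 / (real k + 1)} (\<lambda>x.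
            integral {(1 - x) / (real k + 1) .. x} (\<lambda>y. 6 / (pi\<^sup>2 * x * (1 - y))))
        + integral {1 / (real k + 1) .. 1} (\<lambda>x.
            integral {(1 - x) / (real k + 1) .. (1 - x) / real k} (\<lambda>y. 6 / (pi\<^sup>2 * x * (1 - y)))))"
  using AE_digit_frequencies measure_subtriangle_0 measure_subtriangle_pos
  by (simp add: p_freq_eq)

end
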